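(* Let $P$ be a projection algebra, let $S$ be any projection-generated regular $*$-semigroup with $P=\mathsf P(S)$, and let $p_0\in P$ be arbitrary. Let $D$ be the $\mathscr D$-class of $S$ containing $p_0$, let $E_D$ be the set of idempotents of $S$ lying in $D$, and let $T$ be any spanning tree for the Graham--Houghton graph $\mathsf{GH}(D)$, identified with a subset of $E_D$. Then the maximal subgroup of $\mathsf{PG}(P)$ containing $x_{p_0}$ is defined by the group presentation with generators $\{a_e: e\in E_D\}$ and relations \begin{align*} &a_e=1 && \text{for all } e\in T,\\ &a_{ee^*}^{-1}a_e=a_{e^*}^{-1}a_{e^*e} && \text{for all } e\in E_D,\\ &a_e^{-1}a_f=a_g^{-1}a_h && \text{for all singular squares } \begin{pmatrix} e & f \\ g & h \end{pmatrix} \text{ of idempotents in } D. \end{align*}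
   Context: A regular $*$-semigroup is a semigroup $S$ with a unary operation $a\mapsto a^*$ satisfying $(a^* )^*=a=aa^*a$ and $(ab)^*=b^*a^*$. A projection is an element $p$ with $p^2=p=p^*$; $\mathsf P(S)$ is the set of projections, and for $p,q\in \mathsf P(S)$ one has $pqp\in \mathsf P(S)$. The set $P=\mathsf P(S)$ with the unary operations $q\mapsto pqp$ ($p\in P$) is the projection algebra of $S$; every (abstract) projection algebra is of this form. $S$ is projection-generated if it is generated as a semigroup by $\mathsf P(S)$. $\mathsf{PG}(P)$ is the semigroup defined by the semigroup presentation with generators $x_p$ ($p\in P$) and relations $x_p^2=x_p$, $(x_px_q)^2=x_px_q$, $x_px_qx_p=x_{pqp}$ ($p,q\in P$). The maximal subgroup containing the idempotent $x_{p_0}$ is its $\mathscr H$-class in $\mathsf{PG}(P)$. The Graham--Houghton graph $\mathsf{GH}(D)$ is the bipartite graph whose vertex set is the disjoint union of the set of $\mathscr R$-classes in $D$ and the set of $\mathscr L$-classes in $D$, with an edge joining an $\mathscr R$-class $R$ and an $\mathscr L$-class $L$ iff $R\cap L$ is a group, equivalently contains an idempotent; this edge is identified with that (unique) idempotent, so edge sets are subsets of $E_D$. A square of idempotents is an array $\begin{pmatrix} e & f \\ g & h \end{pmatrix}$ of (not necessarily distinct) idempotents of $S$ with $e\,\mathscr R\,f$, $g\,\mathscr R\,h$, $e\,\mathscr L\,g$, $f\,\mathscr L\,h$. It is LR-singularised by an idempotent $u$ of $S$ if $ue=e$, $ug=g$, $eu=f$, $gu=h$, and UD-singularised by $u$ if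 $eu=e$, $fu=f$, $ue=g$, $uf=h$. It is RL-singularised (resp. DU-singularised) by $u$ if the square obtained by swapping its columns (resp. rows) is LR-singularised (resp. UD-singularised) by $u$. It is a singular square if it is LR-, RL-, UD- or DU-singularised by some idempotent $u$ of $S$. *)

theory Defs
  imports "HOL-Algebra.Group"
begin

record 'a semigrp = "'a partial_object" +
  times :: "['a, 'a] \<Rightarrow> 'a"  (infixl \<open>\<cdot>\<index>\<close> 70)

record 'a star_semigrp = "'a semigrp" +
  star :: "'a \<Rightarrow> 'a"

locale regular_star_semigroup =
  fixes S :: "('a, 'b) star_semigrp_scheme" (structure)
  assumes closed: "a \<in> carrier S \<Longrightarrow> b \<in> carrier S \<Longrightarrow> a \<cdot> b \<in> carrier S"
    and assoc: "a \<in> carrier S \<Longrightarrow> b \<in> carrier S \<Longrightarrow> c \<in> carrier S \<Longrightarrow>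
      (a \<cdot> b) \<cdot> c = a \<cdot> (b \<cdot> c)"
    and star_closed: "a \<in> carrier S \<Longrightarrow> star S a \<in> carrier S"
    and star_star: "a \<in> carrier S \<Longrightarrow> star S (star S a) = a"
    and regular: "a \<in> carrier S \<Longrightarrow> a \<cdot> star S a \<cdot> a = a"
    and star_mult: "a \<in> carrier S \<Longrightarrow> b \<in> carrier S \<Longrightarrow>
      star S (a \<cdot> b) = star S b \<cdot> star S a"

definition idempotents :: "('a, 'b) semigrp_scheme \<Rightarrow> 'a set" where
  "idempotents S = {e \<in> carrier S. e \<cdot>\<^bsub>S\<^esub> e = e}"

definition projections :: "('a, 'b) star_semigrp_scheme \<Rightarrow> 'a set" where
  "projections S = {p \<in> carrier S. p \<cdot>\<^bsub>S\<^esub> p = p \<and> star S p = p}"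

inductive_set generated_subsemigroup :: "('a, 'b) semigrp_scheme \<Rightarrow> 'a set \<Rightarrow> 'a set"
  for S A where
    gen: "a \<in> A \<Longrightarrow> a \<in> generated_subsemigroup S A"
  | mult: "a \<in> generated_subsemigroup S A \<Longrightarrow> b \<in> generated_subsemigroup S A \<Longrightarrow>
      a \<cdot>\<^bsub>S\<^esub> b \<in> generated_subsemigroup S A"

definition projection_generated :: "('a, 'b) star_semigrp_scheme \<Rightarrow> bool" where
  "projection_generated S \<longleftrightarrow> generated_subsemigroup S (projections S) = carrier S"


section \<open>Projection algebras\<close>

text \<open>\<open>theta P p q\<close> is the image of \<open>q\<close> under the unary operation attached to \<open>p\<close>.\<close>

record 'a proj_alg = "'a partial_object" +
  theta :: "'a \<Rightarrow> 'a \<Rightarrow> 'a"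

text \<open>\<open>P\<close> is the projection algebra of \<open>S\<close>; the values of \<open>theta\<close> outside the carrier are irrelevant.\<close>

definition projection_algebra_of ::
    "('a, 'b) star_semigrp_scheme \<Rightarrow> ('a, 'c) proj_alg_scheme \<Rightarrow> bool" where
  "projection_algebra_of S P \<longleftrightarrow>
     carrier P = projections S \<and>
     (\<forall>p \<in> carrier P. \<forall>q \<in> carrier P. theta P p q = p \<cdot>\<^bsub>S\<^esub> q \<cdot>\<^bsub>S\<^esub> p)"


section \<open>Green's relations\<close>

text \<open>\<open>a S\<^sup>1\<close> and \<open>S\<^sup>1 a\<close>\<close>

definition right_ideal :: "('a, 'b) semigrp_scheme \<Rightarrow> 'a \<Rightarrow> 'a set" where
  "right_ideal S a = insert a {a \<cdot>\<^bsub>S\<^esub> s | s. s \<in> carrier S}"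

definition left_ideal :: "('a, 'b) semigrp_scheme \<Rightarrow> 'a \<Rightarrow> 'a set" where
  "left_ideal S a = insert a {s \<cdot>\<^bsub>S\<^esub> a | s. s \<in> carrier S}"

definition green_R :: "('a, 'b) semigrp_scheme \<Rightarrow> 'a rel" where
  "green_R S = {(a, b) \<in> carrier S \<times> carrier S. right_ideal S a = right_ideal S b}"

definition green_L :: "('a, 'b) semigrp_scheme \<Rightarrow> 'a rel" where
  "green_L S = {(a, b) \<in> carrier S \<times> carrier S. left_ideal S a = left_ideal S b}"

definition green_H :: "('a, 'b) semigrp_scheme \<Rightarrow> 'a rel" where
  "green_H S = green_R S \<inter> green_L S"

definition green_D :: "('a, 'b) semigrp_scheme \<Rightarrow> 'a rel" where
  "green_D S = green_R S O green_L S"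

definition maximal_subgroup :: "('a, 'b) semigrp_scheme \<Rightarrow> 'a \<Rightarrow> 'a monoid" where
  "maximal_subgroup S e =
     \<lparr>carrier = green_H S `` {e}, mult = (\<lambda>a b. a \<cdot>\<^bsub>S\<^esub> b), one = e\<rparr>"


section \<open>Presentations\<close>

text \<open>The congruence on the free monoid over the alphabet \<open>A\<close> generated by the pairs of words
  in \<open>R\<close>. If \<open>R\<close> consists of pairs of nonempty words, its restriction to nonempty words is the
  congruence on the free semigroup generated by \<open>R\<close>.\<close>

inductive_set word_cong :: "'x set \<Rightarrow> ('x list \<times> 'x list) set \<Rightarrow> 'x list rel"
  for A R where
    refl: "w \<in> lists A \<Longrightarrow> (w, w) \<in> word_cong A R"
  | sym: "(u, v) \<in> word_cong A R \<Longrightarrow> (v, u) \<in> word_cong A R"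
  | trans: "(u, v) \<in> word_cong A R \<Longrightarrow> (v, w) \<in> word_cong A R \<Longrightarrow> (u, w) \<in> word_cong A R"
  | rel: "(u, v) \<in> R \<Longrightarrow> u \<in> lists A \<Longrightarrow> v \<in> lists A \<Longrightarrow> x \<in> lists A \<Longrightarrow> y \<in> lists A \<Longrightarrow>
      (x @ u @ y, x @ v @ y) \<in> word_cong A R"

definition class_mult :: "'x list rel \<Rightarrow> 'x list set \<Rightarrow> 'x list set \<Rightarrow> 'x list set" where
  "class_mult C X Y = C `` {u @ v | u v. u \<in> X \<and> v \<in> Y}"

definition semigroup_presentation ::
    "'x set \<Rightarrow> ('x list \<times> 'x list) set \<Rightarrow> 'x list set semigrp" where
  "semigroup_presentation A R =
     \<lparr>carrier = (lists A - {[]}) // word_cong A R, times = class_mult (word_cong A R)\<rparr>"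

text \<open>Group words are lists of letters \<open>(a, True)\<close>, standing for \<open>a\<close>, and \<open>(a, False)\<close>,
  standing for the inverse of \<open>a\<close>.\<close>

type_synonym 'x gword = "('x \<times> bool) list"

abbreviation gen :: "'x \<Rightarrow> 'x gword" where
  "gen a \<equiv> [(a, True)]"

abbreviation gen_inv :: "'x \<Rightarrow> 'x gword" where
  "gen_inv a \<equiv> [(a, False)]"

definition group_cong :: "'x set \<Rightarrow> ('x gword \<times> 'x gword) set \<Rightarrow> 'x gword rel" where
  "group_cong A R = word_cong (A \<times> UNIV)
     (R \<union> {(gen a @ gen_inv a, []) | a. a \<in> A} \<union> {(gen_inv a @ gen a, []) | a. a \<in> A})"

definition group_presentation ::
    "'x set \<Rightarrow> ('x gword \<times> 'x gword) set \<Rightarrow> 'x gword set monoid" where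
  "group_presentation A R =
     \<lparr>carrier = lists (A \<times> UNIV) // group_cong A R,
      mult = class_mult (group_cong A R),
      one = group_cong A R `` {[]}\<rparr>"


section \<open>The semigroup \<open>PG(P)\<close>\<close>

definition PG_rels :: "('a, 'c) proj_alg_scheme \<Rightarrow> ('a list \<times> 'a list) set" where
  "PG_rels P =
     {([p, p], [p]) | p. p \<in> carrier P} \<union>
     {([p, q, p, q], [p, q]) | p q. p \<in> carrier P \<and> q \<in> carrier P} \<union>
     {([p, q, p], [theta P p q]) | p q. p \<in> carrier P \<and> q \<in> carrier P}"

definition PG :: "('a, 'c) proj_alg_scheme \<Rightarrow> 'a list set semigrp" where
  "PG P = semigroup_presentation (carrier P) (PG_rels P)"

definition PG_gen :: "('a, 'c) proj_alg_scheme \<Rightarrow> 'a \<Rightarrow> 'a list set" where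
  "PG_gen P p = word_cong (carrier P) (PG_rels P) `` {[p]}"


section \<open>Graphs and the Graham--Houghton graph\<close>

text \<open>Simple undirected graphs: a set of vertices and a set of two-element sets of vertices.
  The spanning trees of the AFP entry \<open>Graph_Theory\<close> do not fit, as acyclicity there means that
  there are no directed cycles.\<close>

type_synonym 'v graph = "'v set \<times> 'v set set"

definition connected_graph :: "'v graph \<Rightarrow> bool" where
  "connected_graph G \<longleftrightarrow> fst G \<noteq> {} \<and>
     (\<forall>u \<in> fst G. \<forall>v \<in> fst G. (u, v) \<in> {(x, y). {x, y} \<in> snd G}\<^sup>*)"

definition graph_cycle :: "'v graph \<Rightarrow> 'v list \<Rightarrow> bool" where
  "graph_cycle G vs \<longleftrightarrow> length vs \<ge> 3 \<and> distinct vs \<and>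
     (\<forall>i < length vs. {vs ! i, vs ! (Suc i mod length vs)} \<in> snd G)"

definition tree_graph :: "'v graph \<Rightarrow> bool" where
  "tree_graph G \<longleftrightarrow> connected_graph G \<and> (\<nexists>vs. graph_cycle G vs)"

definition spanning_tree_edges :: "'v graph \<Rightarrow> 'v set set \<Rightarrow> bool" where
  "spanning_tree_edges G F \<longleftrightarrow> F \<subseteq> snd G \<and> tree_graph (fst G, F)"

definition GH_graph :: "('a, 'b) semigrp_scheme \<Rightarrow> 'a set \<Rightarrow> ('a set + 'a set) graph" where
  "GH_graph S D =
     (D // green_R S <+> D // green_L S,
      {{Inl X, Inr Y} | X Y. X \<in> D // green_R S \<and> Y \<in> D // green_L S \<and>
                             X \<inter> Y \<inter> idempotents S \<noteq> {}})"

definition GH_edge :: "('a, 'b) semigrp_scheme \<Rightarrow> 'a \<Rightarrow> ('a set + 'a set) set" where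
  "GH_edge S e = {Inl (green_R S `` {e}), Inr (green_L S `` {e})}"

text \<open>A set \<open>T\<close> of idempotents of \<open>D\<close> stands for the set of the edges of its elements; distinct
  idempotents have distinct edges, since an \<open>\<H>\<close>-class contains at most one idempotent.\<close>

definition GH_spanning_tree :: "('a, 'b) semigrp_scheme \<Rightarrow> 'a set \<Rightarrow> 'a set \<Rightarrow> bool" where
  "GH_spanning_tree S D T \<longleftrightarrow>
     T \<subseteq> idempotents S \<inter> D \<and> spanning_tree_edges (GH_graph S D) (GH_edge S ` T)"


section \<open>Singular squares\<close>

text \<open>The arguments \<open>e f g h\<close> are the entries of the array, row by row.\<close>

definition idempotent_square ::
    "('a, 'b) semigrp_scheme \<Rightarrow> 'a \<Rightarrow> 'a \<Rightarrow> 'a \<Rightarrow> 'a \<Rightarrow> bool" where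
  "idempotent_square S e f g h \<longleftrightarrow>
     {e, f, g, h} \<subseteq> idempotents S \<and>
     (e, f) \<in> green_R S \<and> (g, h) \<in> green_R S \<and> (e, g) \<in> green_L S \<and> (f, h) \<in> green_L S"

definition LR_singularised ::
    "('a, 'b) semigrp_scheme \<Rightarrow> 'a \<Rightarrow> 'a \<Rightarrow> 'a \<Rightarrow> 'a \<Rightarrow> 'a \<Rightarrow> bool" where
  "LR_singularised S u e f g h \<longleftrightarrow>
     u \<cdot>\<^bsub>S\<^esub> e = e \<and> u \<cdot>\<^bsub>S\<^esub> g = g \<and> e \<cdot>\<^bsub>S\<^esub> u = f \<and> g \<cdot>\<^bsub>S\<^esub> u = h"

definition UD_singularised ::
    "('a, 'b) semigrp_scheme \<Rightarrow> 'a \<Rightarrow> 'a \<Rightarrow> 'a \<Rightarrow> 'a \<Rightarrow> 'a \<Rightarrow> bool" where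
  "UD_singularised S u e f g h \<longleftrightarrow>
     e \<cdot>\<^bsub>S\<^esub> u = e \<and> f \<cdot>\<^bsub>S\<^esub> u = f \<and> u \<cdot>\<^bsub>S\<^esub> e = g \<and> u \<cdot>\<^bsub>S\<^esub> f = h"

definition singular_square ::
    "('a, 'b) semigrp_scheme \<Rightarrow> 'a \<Rightarrow> 'a \<Rightarrow> 'a \<Rightarrow> 'a \<Rightarrow> bool" where
  "singular_square S e f g h \<longleftrightarrow>
     idempotent_square S e f g h \<and>
     (\<exists>u \<in> idempotents S.
        LR_singularised S u e f g h \<or> LR_singularised S u f e h g \<or>
        UD_singularised S u e f g h \<or> UD_singularised S u g h e f)"

end

theory Submission
  imports Defs
begin

text \<open>
Reversal of words makes \<open>PG(P)\<close> a regular \<open>*\<close>-semigroup, in which an element \<open>a\<close> is regarded as an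
arrow from \<open>a a\<^sup>*\<close> to \<open>a\<^sup>* a\<close>. Let \<open>G\<close> be the presented group. The generators of \<open>PG(P)\<close> act partially
from the right on the pairs of a projection of \<open>D\<close> and an element of \<open>G\<close>: the letter \<open>r\<close> takes \<open>(p, g)\<close>
to \<open>(q, g b(p, q))\<close> with \<open>q = r p r\<close>, provided that \<open>p r p = p\<close>, where \<open>b(p, q)\<close> is the product of the
inverse of \<open>a\<^sub>p\<close> and the generator of the idempotent \<open>p q\<close>. The relations of \<open>G\<close> for pairs \<open>e, e\<^sup>*\<close> say
that \<open>b(q, p)\<close> is the inverse of \<open>b(p, q)\<close>; together with the singular squares they make this action
respect the defining relations of \<open>PG(P)\<close>. Acting on \<open>(p\<^sub>0, 1)\<close> gives a homomorphism \<open>\<gamma>\<close> from the maximal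
subgroup to \<open>G\<close>. Conversely, \<open>T\<close> provides arrows \<open>rho p\<close> and \<open>lam q\<close> from \<open>p\<^sub>0\<close> to the vertices of
\<open>GH(D)\<close>, and \<open>a\<^sub>e \<mapsto> rho(e e\<^sup>*) e lam(e\<^sup>* e)\<^sup>*\<close> respects the relations of \<open>G\<close> and thus induces a
homomorphism \<open>\<psi>\<close> in the other direction. The two homomorphisms are mutually inverse.
\<close>

section \<open>Semigroup and group presentations\<close>

lemma word_cong_lists: "(u, v) \<in> word_cong A R \<Longrightarrow> u \<in> lists A \<and> v \<in> lists A"
  by (induction rule: word_cong.induct) auto

lemma equiv_word_cong: "equiv (lists A) (word_cong A R)"
proof (rule equivI)
  show "word_cong A R \<subseteq> lists A \<times> lists A"
    by (intro subrelI SigmaI) (simp_all only: word_cong_lists)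
  show "refl_on (lists A) (word_cong A R)" by (rule refl_onI) (rule word_cong.refl)
  show "sym (word_cong A R)" by (rule symI) (rule word_cong.sym)
  show "trans (word_cong A R)" by (rule transI) (rule word_cong.trans)
qed

text \<open>Only the rule \<open>rel\<close> carries a context; the other rules pass a context
  through unchanged, and in \<open>rel\<close> the two contexts concatenate.\<close>

lemma word_cong_append_context:
  "(u, v) \<in> word_cong A R \<Longrightarrow> x \<in> lists A \<Longrightarrow> y \<in> lists A \<Longrightarrow> (x @ u @ y, x @ v @ y) \<in> word_cong A R"
proof (induction rule: word_cong.induct)
  case (refl w)
  then show ?case by (intro word_cong.refl) auto
next
  case (sym u v)
  then show ?case by (intro word_cong.sym[of "x @ u @ y"]) auto
next
  case (trans u v w)
  then show ?case using word_cong.trans[of "x @ u @ y" "x @ v @ y"] by blast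
next
  case (rel u v x' y')
  then have "((x @ x') @ u @ (y' @ y), (x @ x') @ v @ (y' @ y)) \<in> word_cong A R"
    by (intro word_cong.rel) auto
  then show ?case by simp
qed

lemma word_cong_append:
  assumes "(u, u') \<in> word_cong A R" and "(v, v') \<in> word_cong A R"
  shows "(u @ v, u' @ v') \<in> word_cong A R"
  using word_cong_append_context[OF assms(1), of "[]" v] word_cong_append_context[OF assms(2), of u' "[]"]
    word_cong_lists[OF assms(1)] word_cong_lists[OF assms(2)] word_cong.trans[of "u @ v" "u' @ v"]
  by auto

lemma word_cong_class_eq_iff:
  assumes "u \<in> lists A" "v \<in> lists A"
  shows "word_cong A R `` {u} = word_cong A R `` {v} \<longleftrightarrow> (u, v) \<in> word_cong A R"
  by (rule eq_equiv_class_iff[OF equiv_word_cong assms])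

lemma word_cong_class_rel:
  assumes "(u, v) \<in> R" "u \<in> lists A" "v \<in> lists A"
  shows "word_cong A R `` {u} = word_cong A R `` {v}"
  using word_cong.rel[OF assms, of "[]" "[]"] word_cong_class_eq_iff[OF assms(2,3)] by auto

text \<open>The product saturates all concatenations of members; compatibility with concatenation
  lets it be computed on representatives.\<close>

lemma class_mult_word_cong:
  assumes "u \<in> lists A" "v \<in> lists A"
  shows "class_mult (word_cong A R) (word_cong A R `` {u}) (word_cong A R `` {v})
    = word_cong A R `` {u @ v}"
proof (intro equalityI subsetI)
  fix w assume "w \<in> class_mult (word_cong A R) (word_cong A R `` {u}) (word_cong A R `` {v})"
  then obtain u' v' where *: "(u, u') \<in> word_cong A R" "(v, v') \<in> word_cong A R"
    and w: "(u' @ v', w) \<in> word_cong A R"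
    unfolding class_mult_def by auto
  show "w \<in> word_cong A R `` {u @ v}" using word_cong.trans[OF word_cong_append[OF *] w] by simp
next
  fix w assume w: "w \<in> word_cong A R `` {u @ v}"
  have "(u, u) \<in> word_cong A R" "(v, v) \<in> word_cong A R"
    using assms by (simp_all add: word_cong.refl)
  then show "w \<in> class_mult (word_cong A R) (word_cong A R `` {u}) (word_cong A R `` {v})"
    using w unfolding class_mult_def by auto
qed

text \<open>A right action of the letters that respects the defining relations factors through the
  congruence. The invariant set \<open>X\<close> allows actions whose relations hold only on part of
  the type.\<close>

lemma foldl_word_cong:
  assumes "(u, v) \<in> word_cong A R" and "s \<in> X"
    and closed: "\<And>s a. s \<in> X \<Longrightarrow> a \<in> A \<Longrightarrow> f s a \<in> X"
    and rel: "\<And>s u v. (u, v) \<in> R \<Longrightarrow> u \<in> lists A \<Longrightarrow> v \<in> lists A \<Longrightarrow> s \<in> X \<Longrightarrow> foldl f s u = foldl f s v"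
  shows "foldl f s u = foldl f s v"
  using assms(1,2)
proof (induction arbitrary: s rule: word_cong.induct)
  case (sym u v)
  show ?case by (rule sym.IH[OF sym.prems, symmetric])
next
  case (trans u v w)
  show ?case by (rule HOL.trans[OF trans.IH(1)[OF trans.prems] trans.IH(2)[OF trans.prems]])
next
  case (rel u v x y)
  have "x \<in> lists A \<Longrightarrow> s \<in> X \<Longrightarrow> foldl f s x \<in> X" for x s
    by (induction x arbitrary: s) (auto intro: closed)
  then show ?case using rel assms(4) by simp
qed (rule HOL.refl)

text \<open>The left-handed counterpart, needed for evaluating group words from the right
  end.\<close>

lemma foldr_word_cong:
  assumes "(u, v) \<in> word_cong A R" and "s \<in> X"
    and closed: "\<And>s a. s \<in> X \<Longrightarrow> a \<in> A \<Longrightarrow> f a s \<in> X"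
    and rel: "\<And>s u v. (u, v) \<in> R \<Longrightarrow> u \<in> lists A \<Longrightarrow> v \<in> lists A \<Longrightarrow> s \<in> X \<Longrightarrow> foldr f u s = foldr f v s"
  shows "foldr f u s = foldr f v s"
  using assms(1,2)
proof (induction arbitrary: s rule: word_cong.induct)
  case (sym u v)
  show ?case by (rule sym.IH[OF sym.prems, symmetric])
next
  case (trans u v w)
  show ?case by (rule HOL.trans[OF trans.IH(1)[OF trans.prems] trans.IH(2)[OF trans.prems]])
next
  case (rel u v x y)
  have "x \<in> lists A \<Longrightarrow> s \<in> X \<Longrightarrow> foldr f x s \<in> X" for x s
    by (induction x) (auto intro: closed)
  then show ?case using rel assms(4) by simp
qed (rule HOL.refl)

section \<open>Group presentations and their universal property\<close>

locale group_pres =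
  fixes A :: "'x set" and R :: "('x gword \<times> 'x gword) set"
begin

definition gcls :: "'x gword \<Rightarrow> 'x gword set" where
  "gcls w = group_cong A R `` {w}"

abbreviation gwords :: "'x gword set" where
  "gwords \<equiv> lists (A \<times> UNIV)"

abbreviation grp :: "'x gword set monoid" where
  "grp \<equiv> group_presentation A R"

lemma carrier_grp: "carrier grp = gcls ` gwords"
  unfolding group_presentation_def gcls_def quotient_def by auto

lemma mult_gcls: "u \<in> gwords \<Longrightarrow> v \<in> gwords \<Longrightarrow> gcls u \<otimes>\<^bsub>grp\<^esub> gcls v = gcls (u @ v)"
  unfolding group_presentation_def gcls_def group_cong_def by (simp add: class_mult_word_cong)

lemma one_grp: "\<one>\<^bsub>grp\<^esub> = gcls []"
  unfolding group_presentation_def gcls_def by simp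

lemma gcls_rel: "(u, v) \<in> R \<Longrightarrow> u \<in> gwords \<Longrightarrow> v \<in> gwords \<Longrightarrow> gcls u = gcls v"
  unfolding gcls_def group_cong_def by (rule word_cong_class_rel) simp_all

lemma gcls_letter_cancel:
  assumes "a \<in> A" shows "gcls [(a, \<not> b), (a, b)] = gcls []"
proof -
  have "([(a, \<not> b), (a, b)], []) \<in>
      R \<union> {(gen a @ gen_inv a, []) | a. a \<in> A} \<union> {(gen_inv a @ gen a, []) | a. a \<in> A}"
    using assms by (cases b) auto
  then show ?thesis
    unfolding gcls_def group_cong_def by (rule word_cong_class_rel) (use assms in simp_all)
qed

text \<open>Each letter at the front of the word is undone by its opposite at the end of the
  inverse. Left inverses are all that \<open>groupI\<close> asks for.\<close>

lemma gcls_left_inverse: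
  "w \<in> gwords \<Longrightarrow> \<exists>v \<in> gwords. gcls (v @ w) = gcls []"
proof (induction w)
  case Nil
  then show ?case by auto
next
  case (Cons l w)
  obtain a b where l: "l = (a, b)" "a \<in> A" using Cons.prems by auto
  obtain v where v: "v \<in> gwords" "gcls (v @ w) = gcls []" using Cons by auto
  have w: "w \<in> gwords" using Cons.prems by auto
  have "gcls (v @ [(a, \<not> b), (a, b)] @ w) = gcls v \<otimes>\<^bsub>grp\<^esub> (gcls [] \<otimes>\<^bsub>grp\<^esub> gcls w)"
    unfolding gcls_letter_cancel[OF l(2), of b, symmetric] using v w l by (simp add: mult_gcls)
  also have "\<dots> = gcls []" using v w by (simp add: mult_gcls)
  finally show ?case using v l by (intro bexI[of _ "v @ [(a, \<not> b)]"]) auto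
qed

lemma group_grp: "group grp"
proof (rule groupI)
  fix x assume "x \<in> carrier grp"
  then obtain w where w: "x = gcls w" "w \<in> gwords" unfolding carrier_grp by blast
  then obtain v where "v \<in> gwords" "gcls (v @ w) = gcls []" using gcls_left_inverse by blast
  then show "\<exists>y\<in>carrier grp. y \<otimes>\<^bsub>grp\<^esub> x = \<one>\<^bsub>grp\<^esub>"
    using w unfolding carrier_grp by (intro bexI[of _ "gcls v"]) (simp_all add: mult_gcls one_grp)
qed (auto simp: carrier_grp one_grp mult_gcls intro!: imageI del: in_listsD in_listsI)

definition agen :: "'x \<Rightarrow> 'x gword set" where
  "agen a = gcls (gen a)"

lemma agen_closed: "a \<in> A \<Longrightarrow> agen a \<in> carrier grp"
  unfolding carrier_grp agen_def by auto

lemma gcls_gen_inv: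
  assumes "a \<in> A" shows "gcls (gen_inv a) = inv\<^bsub>grp\<^esub> agen a"
proof -
  interpret group grp by (rule group_grp)
  have "gcls (gen_inv a) \<otimes>\<^bsub>grp\<^esub> agen a = \<one>\<^bsub>grp\<^esub>"
    using gcls_letter_cancel[OF assms, of True] assms unfolding agen_def by (simp add: mult_gcls one_grp)
  then show ?thesis using assms agen_closed[OF assms] by (intro inv_equality[symmetric]) (auto simp: carrier_grp)
qed

text \<open>Every element is a product of generators and their inverses; this is induction on the
  length of such a product.\<close>

lemma grp_induct [consumes 1, case_names one gen gen_inv]:
  assumes "z \<in> carrier grp"
    and one: "Q \<one>\<^bsub>grp\<^esub>"
    and gen: "\<And>a z. a \<in> A \<Longrightarrow> z \<in> carrier grp \<Longrightarrow> Q z \<Longrightarrow> Q (agen a \<otimes>\<^bsub>grp\<^esub> z)"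
    and gen_inv: "\<And>a z. a \<in> A \<Longrightarrow> z \<in> carrier grp \<Longrightarrow> Q z \<Longrightarrow> Q (inv\<^bsub>grp\<^esub> agen a \<otimes>\<^bsub>grp\<^esub> z)"
  shows "Q z"
proof -
  have "Q (gcls w)" if "w \<in> gwords" for w
    using that
  proof (induction w rule: list.induct)
    case Nil
    then show ?case using one by (simp add: one_grp)
  next
    case (Cons l w)
    obtain a b where l: "l = (a, b)" "a \<in> A" using Cons.prems by auto
    have w: "w \<in> gwords" "gcls w \<in> carrier grp" using Cons.prems by (auto simp: carrier_grp)
    have "gcls (l # w) = gcls [(a, b)] \<otimes>\<^bsub>grp\<^esub> gcls w"
      using w l by (simp add: mult_gcls)
    also have "\<dots> = (if b then agen a else inv\<^bsub>grp\<^esub> agen a) \<otimes>\<^bsub>grp\<^esub> gcls w"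
      using l by (simp add: agen_def gcls_gen_inv[unfolded agen_def])
    finally show ?case using Cons l w gen gen_inv by auto
  qed
  then show ?thesis using assms(1) unfolding carrier_grp by blast
qed

text \<open>A right fold, so that invariance under the congruence becomes an instance of
  \<open>foldr_word_cong\<close>.\<close>

definition gword_eval :: "('h, 'm) monoid_scheme \<Rightarrow> ('x \<Rightarrow> 'h) \<Rightarrow> 'x gword \<Rightarrow> 'h" where
  "gword_eval H f w =
    foldr (\<lambda>(a, b) h. (if b then f a else inv\<^bsub>H\<^esub> f a) \<otimes>\<^bsub>H\<^esub> h) w \<one>\<^bsub>H\<^esub>"

text \<open>Von Dyck's theorem: evaluation is constant on classes because it respects
  \<open>R\<close> by assumption and the cancellation relations by the group laws.\<close>

lemma universal_property:
  assumes "group H" and f: "f \<in> A \<rightarrow> carrier H"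
    and rel: "\<And>u v. (u, v) \<in> R \<Longrightarrow> u \<in> gwords \<Longrightarrow> v \<in> gwords \<Longrightarrow> gword_eval H f u = gword_eval H f v"
  shows "\<exists>h \<in> hom grp H. \<forall>a \<in> A. h (agen a) = f a"
proof -
  interpret H: group H by fact
  let ?f = "\<lambda>(a, b) h. (if b then f a else inv\<^bsub>H\<^esub> f a) \<otimes>\<^bsub>H\<^esub> h"
  have eval_closed: "gword_eval H f w \<in> carrier H" if "w \<in> gwords" for w
    using that f unfolding gword_eval_def by (induction w rule: list.induct) (auto simp: Pi_iff)
  have foldr_eval: "foldr ?f w s = gword_eval H f w \<otimes>\<^bsub>H\<^esub> s" if "w \<in> gwords" "s \<in> carrier H" for w s
    using that
  proof (induction w rule: list.induct)
    case (Cons l w)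
    moreover have "gword_eval H f w \<in> carrier H" using Cons.prems by (intro eval_closed) auto
    moreover obtain a b where "l = (a, b)" "a \<in> A" using Cons.prems by auto
    ultimately show ?case using f by (auto simp: gword_eval_def H.m_assoc Pi_iff)
  qed (simp add: gword_eval_def)
  have eval_append: "gword_eval H f (u @ v) = gword_eval H f u \<otimes>\<^bsub>H\<^esub> gword_eval H f v"
    if "u \<in> gwords" "v \<in> gwords" for u v
    using foldr_eval[OF that(1) eval_closed[OF that(2)]] unfolding gword_eval_def by simp
  have eval_cong: "gword_eval H f u = gword_eval H f v" if "(u, v) \<in> group_cong A R" for u v
    unfolding gword_eval_def
  proof (rule foldr_word_cong[OF that[unfolded group_cong_def], where X = "carrier H"])
    fix s u v assume uv: "(u, v) \<in> R \<union> {(gen a @ gen_inv a, []) | a. a \<in> A} \<union> {(gen_inv a @ gen a, []) | a. a \<in> A}"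
      and *: "u \<in> gwords" "v \<in> gwords" "s \<in> carrier H"
    from uv consider "(u, v) \<in> R" | a b where "a \<in> A" "u = [(a, \<not> b), (a, b)]" "v = []"
      by force
    then show "foldr ?f u s = foldr ?f v s"
    proof cases
      case 1
      then show ?thesis using rel foldr_eval * by auto
    next
      case 2
      moreover have "f a \<in> carrier H" using f 2 by auto
      ultimately show ?thesis using * by (simp add: H.m_assoc[symmetric])
    qed
  qed (use f in \<open>auto simp: Pi_iff\<close>)
  \<comment> \<open>Evaluation at an arbitrary representative; \<open>eval_cong\<close> makes the
    choice immaterial.\<close>
  define h where "h = (\<lambda>X. gword_eval H f (SOME w. w \<in> X))"
  have h: "h (gcls w) = gword_eval H f w" if "w \<in> gwords" for w
  proof -
    have "w \<in> gcls w" using that unfolding gcls_def group_cong_def by (auto intro: word_cong.refl)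
    then have "(SOME w'. w' \<in> gcls w) \<in> gcls w" by (rule someI)
    then show ?thesis unfolding h_def gcls_def by (auto dest: eval_cong)
  qed
  have "h \<in> hom grp H"
    by (rule homI) (auto simp: carrier_grp h eval_closed mult_gcls eval_append del: in_listsD in_listsI)
  moreover have "h (agen a) = f a" if "a \<in> A" for a
    unfolding agen_def using that f by (subst h) (auto simp: gword_eval_def Pi_iff)
  ultimately show ?thesis by blast
qed

end

section \<open>Potentials on trees\<close>

text \<open>The path is built from its end; whenever the new first vertex already occurs, the detour
  before that occurrence is cut off.\<close>

lemma rtrancl_simple_path:
  assumes "(x, y) \<in> r\<^sup>*"
  shows "\<exists>vs. vs \<noteq> [] \<and> distinct vs \<and> hd vs = x \<and> last vs = y \<and> successively (\<lambda>a b. (a, b) \<in> r) vs"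
  using assms
proof (induction rule: converse_rtrancl_induct)
  case base
  then show ?case by (intro exI[of _ "[y]"]) auto
next
  case (step x z)
  then obtain vs where vs: "vs \<noteq> []" "distinct vs" "hd vs = z" "last vs = y"
    "successively (\<lambda>a b. (a, b) \<in> r) vs" by blast
  show ?case
  proof (cases "x \<in> set vs")
    case True
    then obtain ys zs where "vs = ys @ x # zs" by (meson split_list)
    then show ?thesis using vs by (intro exI[of _ "x # zs"]) (auto simp: successively_append_iff)
  next
    case False
    then show ?thesis using vs step(1) by (intro exI[of _ "x # vs"]) (cases vs, auto)
  qed
qed

text \<open>A simple path from \<open>u\<close> to \<open>v\<close> that avoids the edge would be
  closed to a cycle by that edge.\<close>

lemma acyclic_edge_is_bridge:
  assumes "\<nexists>vs. graph_cycle (V, F) vs" and "{u, v} \<in> F" and "u \<noteq> v"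
  shows "(u, v) \<notin> {(x, y). {x, y} \<in> F - {{u, v}}}\<^sup>*"
proof
  let ?r = "{(x, y). {x, y} \<in> F - {{u, v}}}"
  assume "(u, v) \<in> ?r\<^sup>*"
  then obtain vs where vs: "vs \<noteq> []" "distinct vs" "hd vs = u" "last vs = v"
    "successively (\<lambda>a b. (a, b) \<in> ?r) vs" using rtrancl_simple_path by metis
  obtain a b ws where ab: "vs = a # b # ws" using vs assms(3)
    by (metis last_ConsL list.collapse list.sel(1))
  \<comment> \<open>A path with only two vertices would be the removed edge itself.\<close>
  have "ws \<noteq> []" using vs ab by auto
  then have len: "length vs \<ge> 3" using ab by (cases ws) auto
  have "{vs ! i, vs ! (Suc i mod length vs)} \<in> F" if "i < length vs" for i
  proof (cases "Suc i < length vs")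
    case True
    then show ?thesis using vs(5) by (auto simp: successively_conv_nth)
  next
    case False
    then have "Suc i = length vs" using that by simp
    moreover from this have "vs ! i = v" using vs by (metis diff_Suc_1 last_conv_nth)
    ultimately show ?thesis using vs(1,3) assms(2) by (simp add: hd_conv_nth[symmetric] insert_commute)
  qed
  then have "graph_cycle (V, F) vs" unfolding graph_cycle_def using vs len by simp
  then show False using assms(1) by blast
qed

text \<open>The maps \<open>s u v\<close> transport values along edges and undo each other in
  opposite directions. Transport from the root determines all values, and without cycles no edge can
  contradict them.\<close>

lemma tree_potential:
  fixes s :: "'v \<Rightarrow> 'v \<Rightarrow> 'x \<Rightarrow> 'x"
  assumes tree: "tree_graph (V, F)" and r: "r \<in> V" and x0: "X r x0"
    and edges: "\<And>u v. {u, v} \<in> F \<Longrightarrow> u \<in> V \<and> u \<noteq> v"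
    and step: "\<And>u v x. {u, v} \<in> F \<Longrightarrow> X u x \<Longrightarrow> X v (s u v x) \<and> s v u (s u v x) = x"
  shows "\<exists>f. f r = x0 \<and> (\<forall>v \<in> V. X v (f v)) \<and> (\<forall>u v. {u, v} \<in> F \<longrightarrow> f v = s u v (f u))"
proof -
  define A where "A = {(x, y). {x, y} \<in> F}"
  define d where "d v = (LEAST n. (r, v) \<in> A ^^ n)" for v
  define par where "par v = (SOME u. (u, v) \<in> A \<and> d v = Suc (d u))" for v
  have conn: "(r, v) \<in> A\<^sup>*" if "v \<in> V" for v
    using tree r that unfolding tree_graph_def connected_graph_def A_def by auto
  have reach: "(r, v) \<in> A ^^ d v" if "v \<in> V" for v
    using conn[OF that] unfolding d_def rtrancl_is_UN_relpow by (auto intro: LeastI)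
  have d_r: "d r = 0" unfolding d_def by (rule Least_equality) auto
  have par: "(par v, v) \<in> A \<and> d v = Suc (d (par v))" if v: "v \<in> V" "v \<noteq> r" for v
  proof -
    obtain n where n: "d v = Suc n" using reach[OF v(1)] v(2) by (cases "d v") auto
    then obtain u where u: "(r, u) \<in> A ^^ n" "(u, v) \<in> A" using reach[OF v(1)] by auto
    have "d u \<le> n" unfolding d_def using u(1) by (rule Least_le)
    moreover have "u \<in> V" using u(2) edges unfolding A_def by auto
    then have "(r, v) \<in> A ^^ Suc (d u)" using reach u(2) by auto
    then have "d v \<le> Suc (d u)" unfolding d_def[of v] by (rule Least_le)
    ultimately have "(u, v) \<in> A \<and> d v = Suc (d u)" using u n by simp
    then show ?thesis unfolding par_def by (rule someI)
  qed
  have par_V: "par v \<in> V" if "v \<in> V" "v \<noteq> r" for v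
    using par[OF that] edges unfolding A_def by auto
  \<comment> \<open>Recursion on the distance: stage \<open>n\<close> is meant for vertices at
    distance \<open>n\<close> and consults the parent at the previous stage. At stage 0 the only
    vertex is the root.\<close>
  define val where "val = rec_nat (\<lambda>v. x0) (\<lambda>n g v. s (par v) v (g (par v)))"
  define f where "f v = val (d v) v" for v
  have f_r: "f r = x0" unfolding f_def val_def d_r by simp
  have f_par: "f v = s (par v) v (f (par v))" if "v \<in> V" "v \<noteq> r" for v
    using par[OF that] unfolding f_def val_def by simp
  have X: "X v (f v)" if "v \<in> V" for v
    using that
  proof (induction "d v" arbitrary: v)
    case 0
    then have "v = r" using par by fastforce
    then show ?case using f_r x0 by simp
  next
    case (Suc n)
    then have "v \<noteq> r" using d_r by auto
    then show ?case
      using Suc.hyps(1)[of "par v"] Suc.hyps(2) Suc.prems par[of v] par_V[of v] f_par[of v] step[of "par v" v]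
      unfolding A_def by auto
  qed
  have "f v = s u v (f u)" if e: "{u, v} \<in> F" for u v
  proof -
    have uv: "u \<in> V" "v \<in> V" "u \<noteq> v" using edges[of u v] edges[of v u] e by (auto simp: insert_commute)
    consider "v \<noteq> r" "u = par v" | "u \<noteq> r" "v = par u"
      | "\<not> (v \<noteq> r \<and> u = par v)" "\<not> (u \<noteq> r \<and> v = par u)" by blast
    then show ?thesis
    proof cases
      case 1
      then show ?thesis using f_par uv by simp
    next
      case 2
      then have "f u = s v u (f v)" using f_par uv by simp
      then show ?thesis using step[of v u "f v"] X[OF uv(2)] e by (simp add: insert_commute)
    next
      case 3
      \<comment> \<open>An edge that joins no vertex to its parent is impossible: the parent edges
        would connect both of its ends to the root without it, although it is a bridge.\<close>
      let ?r = "{(x, y). {x, y} \<in> F - {{u, v}}}"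
      have to_r: "(w, r) \<in> ?r\<^sup>*" if "w \<in> V" for w
        using that
      proof (induction "d w" arbitrary: w rule: less_induct)
        case less
        show ?case
        proof (cases "w = r")
          case False
          note p = par[OF less.prems False] par_V[OF less.prems False]
          have "{w, par w} \<noteq> {u, v}" using 3 False by (auto simp: doubleton_eq_iff)
          then have "(w, par w) \<in> ?r" using p unfolding A_def by (auto simp: insert_commute)
          moreover have "(par w, r) \<in> ?r\<^sup>*" using less.hyps[of "par w"] p by simp
          ultimately show ?thesis by (rule converse_rtrancl_into_rtrancl)
        qed simp
      qed
      have "sym (?r\<^sup>*)" by (intro sym_rtrancl symI) (auto simp: insert_commute)
      then have "(u, v) \<in> ?r\<^sup>*" using to_r[OF uv(1)] to_r[OF uv(2)] by (meson symD rtrancl_trans)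
      moreover have "(u, v) \<notin> ?r\<^sup>*"
        using tree e uv(3) unfolding tree_graph_def by (intro acyclic_edge_is_bridge) auto
      ultimately show ?thesis by blast
    qed
  qed
  then show ?thesis using f_r X by blast
qed

section \<open>Regular \<open>*\<close>-semigroups\<close>

context regular_star_semigroup
begin

definition arr :: "'a \<Rightarrow> 'a \<Rightarrow> 'a \<Rightarrow> bool" where
  "arr p a q \<longleftrightarrow> a \<in> carrier S \<and> a \<cdot> star S a = p \<and> star S a \<cdot> a = q"

text \<open>These are the pairs of ends of idempotents: for such a pair \<open>p \<cdot> q\<close>
  is an idempotent and an arrow from \<open>p\<close> to \<open>q\<close>.\<close>

definition friendly :: "'a \<Rightarrow> 'a \<Rightarrow> bool" where
  "friendly p q \<longleftrightarrow> p \<in> projections S \<and> q \<in> projections S \<and> p \<cdot> q \<cdot> p = p \<and> q \<cdot> p \<cdot> q = q"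

lemma proj_carrier: "p \<in> projections S \<Longrightarrow> p \<in> carrier S"
  and proj_idem: "p \<in> projections S \<Longrightarrow> p \<cdot> p = p"
  and proj_star: "p \<in> projections S \<Longrightarrow> star S p = p"
  unfolding projections_def by auto

lemma proj_idem': "p \<in> projections S \<Longrightarrow> a \<in> carrier S \<Longrightarrow> p \<cdot> (p \<cdot> a) = p \<cdot> a"
  by (metis assoc proj_carrier proj_idem)

lemmas proj_simps = proj_carrier proj_idem proj_idem' proj_star
  closed star_closed assoc star_star star_mult

lemma regular': "a \<in> carrier S \<Longrightarrow> a \<cdot> (star S a \<cdot> a) = a"
  using regular by (simp add: assoc star_closed closed)

lemma regular_star: "a \<in> carrier S \<Longrightarrow> star S a \<cdot> (a \<cdot> star S a) = star S a"
  using regular'[of "star S a"] by (simp add: star_closed star_star)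

lemma proj_lproj: "a \<in> carrier S \<Longrightarrow> a \<cdot> star S a \<in> projections S"
  unfolding projections_def by (simp add: proj_simps regular_star)

lemma proj_rproj: "a \<in> carrier S \<Longrightarrow> star S a \<cdot> a \<in> projections S"
  using proj_lproj[of "star S a"] by (simp add: proj_simps)

lemma arr_carrier: "arr p a q \<Longrightarrow> a \<in> carrier S"
  unfolding arr_def by simp

lemma arr_self: "a \<in> carrier S \<Longrightarrow> arr (a \<cdot> star S a) a (star S a \<cdot> a)"
  unfolding arr_def by simp

lemma arr_proj: assumes "arr p a q" shows "p \<in> projections S" "q \<in> projections S"
  using assms proj_lproj proj_rproj unfolding arr_def by auto

lemma arr_id: "p \<in> projections S \<Longrightarrow> arr p p p"
  unfolding arr_def by (simp add: proj_simps)

lemma arr_star: "arr p a q \<Longrightarrow> arr q (star S a) p"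
  unfolding arr_def by (auto simp: proj_simps)

lemma arr_left: "arr p a q \<Longrightarrow> p \<cdot> a = a"
  unfolding arr_def using regular by auto

lemma arr_right: "arr p a q \<Longrightarrow> a \<cdot> q = a"
  unfolding arr_def using regular' by auto

lemma arr_left': "arr p a q \<Longrightarrow> b \<in> carrier S \<Longrightarrow> p \<cdot> (a \<cdot> b) = a \<cdot> b"
  by (metis arr_left arr_carrier arr_proj(1) proj_carrier assoc)

lemma arr_right': "arr p a q \<Longrightarrow> b \<in> carrier S \<Longrightarrow> a \<cdot> (q \<cdot> b) = a \<cdot> b"
  by (metis arr_right arr_carrier arr_proj(2) proj_carrier assoc)

lemma arr_cancel: "arr p a q \<Longrightarrow> a \<cdot> star S a = p" "arr p a q \<Longrightarrow> star S a \<cdot> a = q"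
  unfolding arr_def by auto

lemma arr_comp:
  assumes "arr p a q" "arr q b r" shows "arr p (a \<cdot> b) r"
proof -
  note [simp] = proj_simps arr_carrier[OF assms(1)] arr_carrier[OF assms(2)]
  have "(a \<cdot> b) \<cdot> star S (a \<cdot> b) = a \<cdot> ((b \<cdot> star S b) \<cdot> star S a)" by simp
  also have "\<dots> = a \<cdot> star S a"
    using arr_left[OF arr_star[OF assms(1)]] by (simp only: arr_cancel[OF assms(2)])
  finally have 1: "(a \<cdot> b) \<cdot> star S (a \<cdot> b) = p" using arr_cancel[OF assms(1)] by simp
  have "star S (a \<cdot> b) \<cdot> (a \<cdot> b) = star S b \<cdot> ((star S a \<cdot> a) \<cdot> b)" by simp
  also have "\<dots> = star S b \<cdot> b"
    using arr_left[OF assms(2)] by (simp only: arr_cancel[OF assms(1)])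
  finally have 2: "star S (a \<cdot> b) \<cdot> (a \<cdot> b) = r" using arr_cancel[OF assms(2)] by simp
  show ?thesis unfolding arr_def using 1 2 by (simp del: assoc star_mult)
qed

text \<open>Equal right ideals make each of the two projections absorb the other from the left. As
  the star turns left absorption of projections into right absorption, they coincide.\<close>

lemma green_R_iff:
  assumes a: "a \<in> carrier S" and b: "b \<in> carrier S"
  shows "(a, b) \<in> green_R S \<longleftrightarrow> a \<cdot> star S a = b \<cdot> star S b"
proof
  have le: "(b \<cdot> star S b) \<cdot> (a \<cdot> star S a) = a \<cdot> star S a"
    if a: "a \<in> carrier S" and b: "b \<in> carrier S" and "right_ideal S a = right_ideal S b" for a b
  proof -
    have "a \<in> right_ideal S b" using that unfolding right_ideal_def by auto
    then consider "a = b" | s where "s \<in> carrier S" "a = b \<cdot> s" unfolding right_ideal_def by auto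
    then have "(b \<cdot> star S b) \<cdot> a = a"
    proof cases
      case 2
      then show ?thesis using regular[OF b] b by (metis assoc closed star_closed)
    qed (use regular[OF b] in simp)
    then show ?thesis using a b by (metis assoc closed star_closed)
  qed
  assume "(a, b) \<in> green_R S"
  then have e: "right_ideal S a = right_ideal S b" unfolding green_R_def by simp
  have "star S (a \<cdot> star S a) = star S ((b \<cdot> star S b) \<cdot> (a \<cdot> star S a))" using le[OF a b e] by simp
  also have "\<dots> = (a \<cdot> star S a) \<cdot> (b \<cdot> star S b)" using a b by (simp add: proj_simps)
  also have "\<dots> = b \<cdot> star S b" using le[OF b a] e by simp
  finally show "a \<cdot> star S a = b \<cdot> star S b" using a by (simp add: proj_simps)
next
  have sub: "right_ideal S a \<subseteq> right_ideal S b"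
    if a: "a \<in> carrier S" and b: "b \<in> carrier S" and e: "a \<cdot> star S a = b \<cdot> star S b" for a b
  proof -
    have a': "a = b \<cdot> (star S b \<cdot> a)" using regular[OF a] a b e by (simp add: assoc star_closed)
    have "a \<cdot> s = b \<cdot> (star S b \<cdot> a \<cdot> s)" if "s \<in> carrier S" for s
      by (subst a') (use a b that in \<open>simp add: proj_simps\<close>)
    then show ?thesis using a' a b unfolding right_ideal_def
      by (auto intro: closed star_closed)
  qed
  assume "a \<cdot> star S a = b \<cdot> star S b"
  then have "right_ideal S a = right_ideal S b" using sub[OF a b] sub[OF b a] by auto
  then show "(a, b) \<in> green_R S" unfolding green_R_def using a b by simp
qed

text \<open>The star is an involution that reverses products, which reduces facts on \<L> to facts
  on \<R>.\<close>

lemma left_ideal_star: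
  assumes "a \<in> carrier S" shows "left_ideal S a = star S ` right_ideal S (star S a)"
proof -
  have "s \<cdot> a = star S (star S a \<cdot> star S s)" if "s \<in> carrier S" for s
    using assms that by (simp add: proj_simps)
  moreover have "star S (star S a \<cdot> s) = star S s \<cdot> a" if "s \<in> carrier S" for s
    using assms that by (simp add: proj_simps)
  ultimately show ?thesis unfolding left_ideal_def right_ideal_def
    using assms star_closed star_star by (auto simp: image_iff) metis+
qed

lemma green_L_iff:
  assumes a: "a \<in> carrier S" and b: "b \<in> carrier S"
  shows "(a, b) \<in> green_L S \<longleftrightarrow> star S a \<cdot> a = star S b \<cdot> b"
proof -
  have "right_ideal S x \<subseteq> carrier S" if "x \<in> carrier S" for x
    using that closed unfolding right_ideal_def by auto
  then have "inj_on (star S) (right_ideal S (star S a) \<union> right_ideal S (star S b))"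
    using a b star_closed star_star by (intro inj_on_inverseI[of _ "star S"]) blast
  then have "left_ideal S a = left_ideal S b \<longleftrightarrow> right_ideal S (star S a) = right_ideal S (star S b)"
    unfolding left_ideal_star[OF a] left_ideal_star[OF b] by (intro inj_on_image_eq_iff) auto
  then have "(a, b) \<in> green_L S \<longleftrightarrow> (star S a, star S b) \<in> green_R S"
    unfolding green_L_def green_R_def using a b star_closed by simp
  then show ?thesis using green_R_iff[of "star S a" "star S b"] a b by (simp add: star_closed star_star)
qed

text \<open>The intermediate element in the composition of \<R> and \<L> is exactly such an
  arrow.\<close>

lemma green_D_iff:
  assumes a: "a \<in> carrier S" and b: "b \<in> carrier S"
  shows "(a, b) \<in> green_D S \<longleftrightarrow> (\<exists>c. arr (a \<cdot> star S a) c (star S b \<cdot> b))"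
proof -
  have "(a, c) \<in> green_R S \<and> (c, b) \<in> green_L S \<longleftrightarrow> arr (a \<cdot> star S a) c (star S b \<cdot> b)" for c
  proof (cases "c \<in> carrier S")
    case True
    then show ?thesis unfolding green_R_iff[OF a True] green_L_iff[OF True b] arr_def by auto
  next
    case False
    then show ?thesis unfolding green_R_def arr_def by auto
  qed
  then show ?thesis unfolding green_D_def by blast
qed

section \<open>Idempotents as products of two friendly projections\<close>

lemma idempotent_products:
  assumes "e \<in> idempotents S"
  shows "e \<in> carrier S" "e = (e \<cdot> star S e) \<cdot> (star S e \<cdot> e)"
proof -
  show e: "e \<in> carrier S" using assms unfolding idempotents_def by simp
  have "star S e \<cdot> star S e = star S e"
    using assms e unfolding idempotents_def by (metis (mono_tags, lifting) mem_Collect_eq star_mult)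
  \<comment> \<open>The star of an idempotent is idempotent, so the two middle factors merge and
    regularity applies.\<close>
  then have "(e \<cdot> star S e) \<cdot> (star S e \<cdot> e) = e \<cdot> (star S e \<cdot> e)"
    using e by (metis assoc closed star_closed)
  then show "e = (e \<cdot> star S e) \<cdot> (star S e \<cdot> e)" using e by (simp add: regular')
qed

lemma idempotent_friendly:
  assumes "e \<in> idempotents S"
  shows "friendly (e \<cdot> star S e) (star S e \<cdot> e)"
proof -
  note e = idempotent_products[OF assms]
  have ee: "e \<cdot> e = e" using assms unfolding idempotents_def by simp
  have c: "e \<cdot> star S e \<in> carrier S" "star S e \<cdot> e \<in> carrier S" using e(1) by (auto intro: closed star_closed)
  have "(e \<cdot> star S e) \<cdot> (star S e \<cdot> e) \<cdot> (e \<cdot> star S e) = (e \<cdot> e) \<cdot> star S e"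
    using e(1) by (simp only: e(2)[symmetric] assoc star_closed)
  then have 1: "(e \<cdot> star S e) \<cdot> (star S e \<cdot> e) \<cdot> (e \<cdot> star S e) = e \<cdot> star S e" by (simp only: ee)
  have "(star S e \<cdot> e) \<cdot> (e \<cdot> star S e) \<cdot> (star S e \<cdot> e) = star S e \<cdot> (e \<cdot> e)"
    using e(1) by (simp only: assoc[OF c(2,1,2)] e(2)[symmetric] assoc star_closed)
  then have 2: "(star S e \<cdot> e) \<cdot> (e \<cdot> star S e) \<cdot> (star S e \<cdot> e) = star S e \<cdot> e" by (simp only: ee)
  show ?thesis unfolding friendly_def using 1 2 proj_lproj[OF e(1)] proj_rproj[OF e(1)] by blast
qed

lemma friendly_sym: "friendly p q \<Longrightarrow> friendly q p"
  unfolding friendly_def by auto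

lemma friendly_refl: "p \<in> projections S \<Longrightarrow> friendly p p"
  unfolding friendly_def by (simp add: proj_simps)

lemma friendly_arr: "friendly p q \<Longrightarrow> arr p (p \<cdot> q) q"
  unfolding friendly_def arr_def by (auto simp: proj_simps)

lemma friendly_idempotent: "friendly p q \<Longrightarrow> p \<cdot> q \<in> idempotents S"
  unfolding friendly_def idempotents_def by (auto simp: proj_simps)

lemma friendly_star: "friendly p q \<Longrightarrow> star S (p \<cdot> q) = q \<cdot> p"
  unfolding friendly_def by (simp add: proj_simps)

lemma proj_sandwich: "p \<in> projections S \<Longrightarrow> q \<in> projections S \<Longrightarrow> p \<cdot> q \<cdot> p \<in> projections S"
  using proj_lproj[of "p \<cdot> q"] by (simp add: proj_simps)

text \<open>A letter \<open>r\<close> keeps an arrow \<open>a\<close> with codomain \<open>q\<close> in its \<open>\<R>\<close>-class exactly when \<open>q r q = q\<close>.\<close>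

lemma friendly_sandwich:
  assumes "q \<in> projections S" "r \<in> projections S" "q \<cdot> r \<cdot> q = q"
  shows "friendly q (r \<cdot> q \<cdot> r)" "q \<cdot> (r \<cdot> q \<cdot> r) = q \<cdot> r"
proof -
  note [simp] = proj_simps assms(1,2)
  have a: "q \<cdot> (r \<cdot> q) = q" using assms(3) by simp
  have a': "q \<cdot> (r \<cdot> (q \<cdot> x)) = q \<cdot> x" if "x \<in> carrier S" for x
    using a that by (metis assms(1,2) assoc closed proj_carrier)
  show "friendly q (r \<cdot> q \<cdot> r)" unfolding friendly_def
    using proj_sandwich[OF assms(2,1)] by (simp add: a a')
  show "q \<cdot> (r \<cdot> q \<cdot> r) = q \<cdot> r" using a' by simp
qed

text \<open>By \<open>friendly_sandwich\<close>, multiplying by \<open>r\<close> amounts to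
  composing with the arrow from \<open>q\<close> to \<open>r \<cdot> q \<cdot> r\<close>.\<close>

lemma arr_mult_proj:
  assumes "arr p a q" "r \<in> projections S" "q \<cdot> r \<cdot> q = q"
  shows "arr p (a \<cdot> r) (r \<cdot> q \<cdot> r)"
proof -
  have q: "q \<in> projections S" by (rule arr_proj[OF assms(1)])
  have "a \<cdot> (q \<cdot> (r \<cdot> q \<cdot> r)) = a \<cdot> r"
    using arr_right'[OF assms(1), of r] friendly_sandwich(2)[OF q assms(2,3)] assms(2) by (simp add: proj_carrier)
  then show ?thesis
    using arr_comp[OF assms(1) friendly_arr[OF friendly_sandwich(1)[OF q assms(2,3)]]] by simp
qed

text \<open>\<open>p \<cdot> a = a\<close> gives absorption one way, and \<open>p\<close>, being a
  right multiple of \<open>a\<close>, is absorbed the other way. Thus a word whose value lies in the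
  \<R>-class of \<open>p\<close> does not leave that class at a prefix fixed by
  \<open>p\<close>.\<close>

lemma arr_prefix:
  assumes "arr p (a \<cdot> b) q" "a \<in> carrier S" "b \<in> carrier S" "p \<cdot> a = a"
  shows "a \<cdot> star S a = p"
proof -
  note p = arr_proj(1)[OF assms(1)]
  note [simp] = proj_simps assms(2,3) p
  have 1: "p = a \<cdot> (b \<cdot> (star S b \<cdot> star S a))" using arr_cancel(1)[OF assms(1)] by simp
  have "(a \<cdot> star S a) \<cdot> (a \<cdot> (b \<cdot> (star S b \<cdot> star S a))) = a \<cdot> (b \<cdot> (star S b \<cdot> star S a))"
    by (rule arr_left'[OF arr_self]) simp_all
  then have "(a \<cdot> star S a) \<cdot> p = p" by (simp only: 1[symmetric])
  then have "star S ((a \<cdot> star S a) \<cdot> p) = p" by simp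
  then have "p \<cdot> (a \<cdot> star S a) = p" by simp
  then show ?thesis using assms(4) by (metis assoc assms(2) star_closed p proj_carrier)
qed

end

section \<open>\<open>PG(P)\<close> as a regular \<open>*\<close>-semigroup\<close>

text \<open>The star is elementwise reversal of a class of words; that this is again a class follows
  from \<open>rev_word_cong\<close>.\<close>

definition PG_star :: "('a, 'c) proj_alg_scheme \<Rightarrow> 'a list set star_semigrp" where
  "PG_star P = \<lparr>carrier = carrier (PG P), times = times (PG P), star = (\<lambda>X. rev ` X)\<rparr>"

lemma maximal_subgroup_PG_star: "maximal_subgroup (PG_star P) e = maximal_subgroup (PG P) e"
  unfolding maximal_subgroup_def green_H_def green_R_def green_L_def right_ideal_def left_ideal_def PG_star_def
  by simp

locale proj_alg_of_semigroup = regular_star_semigroup S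
  for S :: "('a, 'b) star_semigrp_scheme" (structure) +
  fixes P :: "('a, 'c) proj_alg_scheme"
  assumes proj_alg: "projection_algebra_of S P"
begin

abbreviation pgmult :: "'a list set \<Rightarrow> 'a list set \<Rightarrow> 'a list set" (infixl \<open>\<odot>\<close> 70) where
  "X \<odot> Y \<equiv> X \<cdot>\<^bsub>PG_star P\<^esub> Y"

definition pcls :: "'a list \<Rightarrow> 'a list set" where
  "pcls w = word_cong (carrier P) (PG_rels P) `` {w}"

abbreviation x :: "'a \<Rightarrow> 'a list set" where
  "x \<equiv> PG_gen P"

section \<open>Words, generators and relations of \<open>PG(P)\<close>\<close>

lemma carrier_P: "carrier P = projections S"
  using proj_alg unfolding projection_algebra_of_def by simp

lemma theta_P: "p \<in> projections S \<Longrightarrow> q \<in> projections S \<Longrightarrow> theta P p q = p \<cdot> q \<cdot> p"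
  using proj_alg unfolding projection_algebra_of_def by simp

lemma x_pcls: "x p = pcls [p]"
  unfolding PG_gen_def pcls_def by simp

lemma carrier_PG_star: "carrier (PG_star P) = pcls ` (lists (projections S) - {[]})"
  unfolding PG_star_def PG_def semigroup_presentation_def pcls_def quotient_def carrier_P by auto

lemma pcls_closed: "w \<in> lists (projections S) \<Longrightarrow> w \<noteq> [] \<Longrightarrow> pcls w \<in> carrier (PG_star P)"
  unfolding carrier_PG_star by auto

lemma pcls_mult:
  "u \<in> lists (projections S) \<Longrightarrow> v \<in> lists (projections S) \<Longrightarrow> pcls u \<odot> pcls v = pcls (u @ v)"
  unfolding PG_star_def PG_def semigroup_presentation_def pcls_def carrier_P
  by (simp add: class_mult_word_cong)

lemma PG_rels_cases [consumes 1, case_names idem square sandwich]: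
  assumes "(u, v) \<in> PG_rels P"
  obtains p where "p \<in> projections S" "u = [p, p]" "v = [p]"
  | p q where "p \<in> projections S" "q \<in> projections S" "u = [p, q, p, q]" "v = [p, q]"
  | p q where "p \<in> projections S" "q \<in> projections S" "u = [p, q, p]" "v = [p \<cdot> q \<cdot> p]"
  using assms unfolding PG_rels_def carrier_P by (auto simp: theta_P)

lemma pcls_rel:
  assumes "(u, v) \<in> PG_rels P"
  shows "pcls u = pcls v"
proof -
  have "u \<in> lists (projections S)" "v \<in> lists (projections S)"
    using assms by (cases rule: PG_rels_cases; auto simp: proj_sandwich)+
  then show ?thesis unfolding pcls_def carrier_P by (rule word_cong_class_rel[OF assms])
qed

text \<open>The set of relations is closed under reversal: the first and third kinds consist of
  palindromes, and reversing the second kind exchanges \<open>p\<close> and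
  \<open>q\<close>.\<close>

lemma rev_word_cong:
  "(u, v) \<in> word_cong (projections S) (PG_rels P) \<Longrightarrow>
    (rev u, rev v) \<in> word_cong (projections S) (PG_rels P)"
proof (induction rule: word_cong.induct)
  case (refl w)
  then show ?case by (intro word_cong.refl) (simp add: in_lists_conv_set)
next
  case (sym u v)
  show ?case by (rule word_cong.sym[OF sym.IH])
next
  case (trans u v w)
  show ?case by (rule word_cong.trans[OF trans.IH])
next
  case (rel u v y z)
  from rel(1) have "(rev u, rev v) \<in> PG_rels P"
    by (cases rule: PG_rels_cases) (auto simp: PG_rels_def carrier_P theta_P)
  then have "(rev z @ rev u @ rev y, rev z @ rev v @ rev y) \<in> word_cong (projections S) (PG_rels P)"
    using rel by (intro word_cong.rel) (simp_all add: in_lists_conv_set)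
  then show ?case by simp
qed

lemma pcls_star: "star (PG_star P) (pcls w) = pcls (rev w)"
proof -
  have "rev v \<in> pcls (rev w)" if "v \<in> pcls w" for v w
    using that rev_word_cong unfolding pcls_def carrier_P by auto
  from this this[of _ "rev w"] have "rev ` pcls w = pcls (rev w)"
    by (force simp: image_iff intro: bexI[of _ "rev _"])
  then show ?thesis unfolding PG_star_def by simp
qed

lemma x_closed: "p \<in> projections S \<Longrightarrow> x p \<in> carrier (PG_star P)"
  unfolding x_pcls by (rule pcls_closed) auto

lemma x_idem: "p \<in> projections S \<Longrightarrow> x p \<odot> x p = x p"
  using pcls_rel[of "[p, p]" "[p]"] by (simp add: x_pcls pcls_mult PG_rels_def carrier_P)

lemma x_square: "p \<in> projections S \<Longrightarrow> q \<in> projections S \<Longrightarrow> x p \<odot> x q \<odot> x p \<odot> x q = x p \<odot> x q"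
  using pcls_rel[of "[p, q, p, q]" "[p, q]"] by (simp add: x_pcls pcls_mult PG_rels_def carrier_P)

lemma x_sandwich:
  assumes "p \<in> projections S" "q \<in> projections S"
  shows "x p \<odot> x q \<odot> x p = x (p \<cdot> q \<cdot> p)"
proof -
  have "([p, q, p], [p \<cdot> q \<cdot> p]) \<in> PG_rels P"
    using assms theta_P unfolding PG_rels_def carrier_P by force
  then show ?thesis using pcls_rel assms by (simp add: x_pcls pcls_mult)
qed

lemma x_star: "p \<in> projections S \<Longrightarrow> star (PG_star P) (x p) = x p"
  unfolding x_pcls by (simp add: pcls_star)

lemma PG_star_closed:
  "X \<in> carrier (PG_star P) \<Longrightarrow> Y \<in> carrier (PG_star P) \<Longrightarrow> X \<odot> Y \<in> carrier (PG_star P)"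
  unfolding carrier_PG_star by (auto simp: pcls_mult intro!: imageI del: in_listsD in_listsI)

lemma PG_star_assoc:
  "X \<in> carrier (PG_star P) \<Longrightarrow> Y \<in> carrier (PG_star P) \<Longrightarrow> Z \<in> carrier (PG_star P) \<Longrightarrow>
    X \<odot> Y \<odot> Z = X \<odot> (Y \<odot> Z)"
  unfolding carrier_PG_star by (auto simp: pcls_mult simp del: in_listsI del: in_listsD in_listsI)

lemma PG_star_induct [consumes 1, case_names gen mult]:
  assumes "z \<in> carrier (PG_star P)"
    and gen: "\<And>p. p \<in> projections S \<Longrightarrow> Q (x p)"
    and mult: "\<And>p z. p \<in> projections S \<Longrightarrow> z \<in> carrier (PG_star P) \<Longrightarrow> Q z \<Longrightarrow> Q (x p \<odot> z)"
  shows "Q z"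
proof -
  have "Q (pcls w)" if "w \<in> lists (projections S)" "w \<noteq> []" for w
    using that
  proof (induction w rule: list.induct)
    case (Cons p w)
    show ?case
    proof (cases "w = []")
      case True
      then show ?thesis using Cons gen[of p] by (simp add: x_pcls)
    next
      case False
      then show ?thesis using Cons mult[of p "pcls w"] by (simp add: x_pcls pcls_mult pcls_closed)
    qed
  qed simp
  then show ?thesis using assms(1) unfolding carrier_PG_star by blast
qed

lemma rev_in_lists: "rev w \<in> lists A \<longleftrightarrow> w \<in> lists A"
  by (simp add: in_lists_conv_set)

lemma PG_star_star_closed:
  assumes "X \<in> carrier (PG_star P)" shows "star (PG_star P) X \<in> carrier (PG_star P)"
proof -
  obtain u where u: "X = pcls u" "u \<in> lists (projections S)" "u \<noteq> []"
    using assms unfolding carrier_PG_star by blast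
  then show ?thesis using pcls_closed[of "rev u"] by (simp add: pcls_star rev_in_lists)
qed

lemma PG_star_star_mult:
  assumes "X \<in> carrier (PG_star P)" and "Y \<in> carrier (PG_star P)"
  shows "star (PG_star P) (X \<odot> Y) = star (PG_star P) Y \<odot> star (PG_star P) X"
proof -
  obtain u v where u: "X = pcls u" "u \<in> lists (projections S)" and v: "Y = pcls v" "v \<in> lists (projections S)"
    using assms unfolding carrier_PG_star by blast
  then show ?thesis by (simp add: pcls_star pcls_mult rev_in_lists)
qed

text \<open>Prefixing a letter \<open>p\<close> turns the projection \<open>x q\<close> of
  \<open>z\<close> into \<open>x p \<odot> x q \<odot> x p\<close>, which is a generator again.
  Regularity follows at once from this description.\<close>

lemma PG_star_lproj:
  assumes "z \<in> carrier (PG_star P)"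
  shows "\<exists>q \<in> projections S. z \<odot> star (PG_star P) z = x q \<and> x q \<odot> z = z"
  using assms
proof (induction rule: PG_star_induct)
  case (gen p)
  then show ?case by (intro bexI[of _ p]) (auto simp: x_star x_idem)
next
  case (mult p z)
  then obtain q where q: "q \<in> projections S" "z \<odot> star (PG_star P) z = x q" "x q \<odot> z = z" by blast
  note c = x_closed[OF mult(1)] x_closed[OF q(1)] mult(2) PG_star_star_closed[OF mult(2)]
    PG_star_closed PG_star_assoc
  note s = x_sandwich[OF mult(1) q(1), symmetric]
  have 1: "(x p \<odot> z) \<odot> star (PG_star P) (x p \<odot> z) = x (p \<cdot> q \<cdot> p)"
  proof -
    have "(x p \<odot> z) \<odot> star (PG_star P) (x p \<odot> z) = x p \<odot> (z \<odot> star (PG_star P) z) \<odot> x p"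
      using mult(1) c by (simp add: PG_star_star_mult x_star)
    then show ?thesis using q(2) s by simp
  qed
  \<comment> \<open>After the sandwich is expanded, \<open>x q\<close> is inserted in front of
    \<open>z\<close>, which it fixes, so that the relation for \<open>x p \<odot> x q\<close>
    squared applies.\<close>
  have "x (p \<cdot> q \<cdot> p) \<odot> (x p \<odot> z) = x p \<odot> (x q \<odot> ((x p \<odot> x p) \<odot> z))"
    unfolding s using c by simp
  also have "\<dots> = x p \<odot> (x q \<odot> (x p \<odot> (x q \<odot> z)))"
    by (simp only: x_idem[OF mult(1)] q(3))
  also have "\<dots> = (x p \<odot> (x q \<odot> (x p \<odot> x q))) \<odot> z"
    using c by simp
  also have "x p \<odot> (x q \<odot> (x p \<odot> x q)) = x p \<odot> x q"
    using x_square[OF mult(1) q(1)] c by simp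
  also have "x p \<odot> x q \<odot> z = x p \<odot> z" using c q(3) by simp
  finally show ?case using 1 proj_sandwich[OF mult(1) q(1)] by blast
qed

sublocale F: regular_star_semigroup "PG_star P"
proof
  fix a assume a: "a \<in> carrier (PG_star P)"
  show "star (PG_star P) (star (PG_star P) a) = a"
    using a unfolding carrier_PG_star by (auto simp: pcls_star)
  show "a \<odot> star (PG_star P) a \<odot> a = a"
    using PG_star_lproj[OF a] by auto
qed (rule PG_star_closed PG_star_assoc PG_star_star_closed PG_star_star_mult; assumption)+

lemma x_proj: "p \<in> projections S \<Longrightarrow> x p \<in> projections (PG_star P)"
  unfolding projections_def[of "PG_star P"] by (simp add: x_closed x_idem x_star)

text \<open>Let words act on \<open>S\<close> by right multiplication: \<open>x p = x q\<close> gives \<open>s \<cdot> p = s \<cdot> q\<close> for all \<open>s\<close>.\<close>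

lemma x_inj:
  assumes "p \<in> projections S" "q \<in> projections S" "x p = x q"
  shows "p = q"
proof -
  have "([p], [q]) \<in> word_cong (projections S) (PG_rels P)"
    using assms word_cong_class_eq_iff[of "[p]" "projections S" "[q]"] by (simp add: x_pcls pcls_def carrier_P)
  then have act: "foldl (\<lambda>s p. s \<cdot> p) s [p] = foldl (\<lambda>s p. s \<cdot> p) s [q]" if "s \<in> carrier S" for s
  proof (rule foldl_word_cong[where X = "carrier S"])
    fix s u v assume "(u, v) \<in> PG_rels P" and s: "s \<in> carrier S"
    then show "foldl (\<lambda>s p. s \<cdot> p) s u = foldl (\<lambda>s p. s \<cdot> p) s v"
    proof (cases rule: PG_rels_cases)
      case (square p q)
      then have "p \<cdot> q \<in> idempotents S"
        unfolding idempotents_def using regular'[of "p \<cdot> q"] by (simp add: proj_simps)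
      then show ?thesis using square s by (simp add: proj_simps idempotents_def)
    qed (auto simp: proj_simps)
  qed (use that in \<open>auto intro: closed proj_carrier\<close>)
  \<comment> \<open>Taking the star of the second equation gives \<open>q = p \<cdot> q\<close>,
    hence \<open>p = q\<close>.\<close>
  have "p = p \<cdot> q" "q = q \<cdot> p" using act[of p] act[of q] assms by (auto simp: proj_simps)
  then show ?thesis using assms by (metis proj_carrier proj_star star_mult)
qed

lemma x_arr: "friendly p q \<Longrightarrow> F.friendly (x p) (x q)"
  unfolding friendly_def F.friendly_def by (simp add: x_proj x_sandwich)

end

section \<open>Idempotents and singular squares in \<open>PG(P)\<close>\<close>

context proj_alg_of_semigroup
begin

text \<open>As \<open>e = (e e\<^sup>*) (e\<^sup>* e)\<close> for an idempotent \<open>e\<close>, this is the idempotent of \<open>PG(P)\<close> lying over \<open>e\<close>.\<close>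

definition xi :: "'a \<Rightarrow> 'a list set" where
  "xi e = x (e \<cdot> star S e) \<odot> x (star S e \<cdot> e)"

lemma xi_arr: "e \<in> idempotents S \<Longrightarrow> F.arr (x (e \<cdot> star S e)) (xi e) (x (star S e \<cdot> e))"
  unfolding xi_def by (intro F.friendly_arr x_arr idempotent_friendly)

lemma star_idempotent: "e \<in> idempotents S \<Longrightarrow> star S e \<in> idempotents S"
  unfolding idempotents_def by (auto simp: star_closed) (metis star_mult)

lemma xi_star: "e \<in> idempotents S \<Longrightarrow> xi (star S e) = star (PG_star P) (xi e)"
  using F.friendly_star[OF x_arr[OF idempotent_friendly, of e]]
  unfolding xi_def by (simp add: idempotent_products star_star)

lemma x_absorb:
  assumes "m \<in> projections S" "p \<in> projections S" "m \<cdot> p = p"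
  shows "x m \<odot> x p = x p" "x p \<odot> x m = x p"
proof -
  have "p \<cdot> m = p" using assms by (metis proj_carrier proj_star star_mult)
  then have "x m \<odot> x p \<odot> x m = x p" using x_sandwich[of m p] assms by (simp add: proj_simps)
  then show "x m \<odot> x p = x p" "x p \<odot> x m = x p"
    using x_idem[OF assms(1)] x_closed[OF assms(1)] x_closed[OF assms(2)] by (metis F.assoc F.closed)+
qed

text \<open>This lifts singularisation from \<open>S\<close> to \<open>PG(P)\<close>. First
  \<open>xi u\<close> fixes \<open>xi e\<close> from the left, so \<open>xi e \<odot> xi u\<close>
  is idempotent; then its two ends are found to be those of \<open>f\<close>, as nested sandwiches
  of generators can be evaluated in \<open>S\<close>.\<close>

lemma xi_mult:
  assumes e: "e \<in> idempotents S" and u: "u \<in> idempotents S" and f: "f \<in> idempotents S"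
    and ue: "u \<cdot> e = e" and eu: "e \<cdot> u = f"
  shows "xi e \<odot> xi u = xi f"
proof -
  define p q m n where "p = e \<cdot> star S e" "q = star S e \<cdot> e" "m = u \<cdot> star S u" "n = star S u \<cdot> u"
  note d = this
  have pq: "friendly p q" and mn: "friendly m n" and e': "e = p \<cdot> q" and u': "u = m \<cdot> n"
    unfolding d using idempotent_friendly idempotent_products(2) e u by blast+
  have P: "p \<in> projections S" "q \<in> projections S" "m \<in> projections S" "n \<in> projections S"
    using pq mn unfolding friendly_def by auto
  have c: "e \<in> carrier S" "u \<in> carrier S" using idempotent_products e u by auto
  note [simp] = P c proj_simps x_closed F.closed F.assoc F.star_closed F.star_mult F.star_star x_star
  have up: "u \<cdot> p = p" unfolding d(1) using ue c by (metis assoc star_closed)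
  have mp: "m \<cdot> p = p"
  proof -
    have "m \<cdot> (u \<cdot> p) = u \<cdot> p"
      using arr_left'[OF arr_self[OF c(2)], of p] unfolding d(3)[symmetric] by simp
    then show ?thesis by (simp only: up)
  qed
  have pm: "p \<cdot> m = p" using mp P by (metis proj_carrier proj_star star_mult)
  have pnp: "p \<cdot> n \<cdot> p = p"
  proof -
    have "p \<cdot> n \<cdot> p = p \<cdot> m \<cdot> n \<cdot> p" by (simp only: pm)
    also have "\<dots> = p \<cdot> (u \<cdot> p)" unfolding u' by simp
    finally show ?thesis by (simp add: up)
  qed
  have absorb: "x m \<odot> x p = x p" "x p \<odot> x m = x p" using x_absorb[OF P(3,1) mp] .
  have mnp: "x m \<odot> x n \<odot> x p = x p"
  proof -
    \<comment> \<open>\<open>y\<close> is shown to start at \<open>x p\<close>, so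
      \<open>x p\<close> fixes it; but multiplying \<open>y\<close> by \<open>x p\<close> also
      collapses it to \<open>x p\<close>.\<close>
    define y where "y = x m \<odot> x n \<odot> x p"
    have y: "y \<in> carrier (PG_star P)" unfolding y_def by simp
    have xs: "x m \<odot> (x n \<odot> x p \<odot> x n) \<odot> x m = x (m \<cdot> (n \<cdot> p \<cdot> n) \<cdot> m)"
      using x_sandwich proj_sandwich P by simp
    have "m \<cdot> (n \<cdot> p \<cdot> n) \<cdot> m = (u \<cdot> p) \<cdot> star S (u \<cdot> p)" unfolding u' by simp
    then have xs': "x (m \<cdot> (n \<cdot> p \<cdot> n) \<cdot> m) = x p" by (simp add: up)
    have "y \<odot> star (PG_star P) y = x m \<odot> (x n \<odot> (x p \<odot> x p) \<odot> x n) \<odot> x m"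
      unfolding y_def by simp
    then have "y \<odot> star (PG_star P) y = x p" using xs xs' x_idem P by simp
    then have "x p \<odot> y = y" using F.regular[OF y] by simp
    moreover have "x p \<odot> y = (x p \<odot> x m) \<odot> x n \<odot> x p" unfolding y_def by simp
    then have "x p \<odot> y = x p" using x_sandwich[OF P(1,4)] pnp by (simp only: absorb)
    ultimately show ?thesis unfolding y_def by simp
  qed
  have xi: "xi e = x p \<odot> x q" "xi u = x m \<odot> x n" unfolding xi_def d by auto
  define z where "z = xi e \<odot> xi u"
  have zc: "z \<in> carrier (PG_star P)" unfolding z_def xi by simp
  have idem_e: "xi e \<odot> xi e = xi e"
    using F.friendly_idempotent[OF x_arr[OF pq]] unfolding idempotents_def xi by simp
  have "xi u \<odot> xi e = (x m \<odot> x n \<odot> x p) \<odot> x q" unfolding xi by simp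
  then have "xi u \<odot> xi e = xi e" by (simp only: mnp xi)
  moreover have "z \<odot> z = xi e \<odot> (xi u \<odot> xi e) \<odot> xi u" unfolding z_def xi by simp
  ultimately have "z \<odot> z = z" unfolding z_def by (simp only: idem_e)
  then have "z \<in> idempotents (PG_star P)" using zc unfolding idempotents_def by simp
  \<comment> \<open>An idempotent is determined by its two ends, so only these have to be
    compared.\<close>
  then have z: "z = (z \<odot> star (PG_star P) z) \<odot> (star (PG_star P) z \<odot> z)"
    by (rule F.idempotent_products(2))
  have "z \<odot> star (PG_star P) z = x p \<odot> (x q \<odot> (x m \<odot> (x n \<odot> x n) \<odot> x m) \<odot> x q) \<odot> x p"
    unfolding z_def xi by simp
  also have "\<dots> = x (p \<cdot> (q \<cdot> (m \<cdot> n \<cdot> m) \<cdot> q) \<cdot> p)"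
    unfolding x_idem[OF P(4)] using x_sandwich proj_sandwich P by (simp del: F.assoc assoc)
  also have "p \<cdot> (q \<cdot> (m \<cdot> n \<cdot> m) \<cdot> q) \<cdot> p = f \<cdot> star S f"
    unfolding eu[symmetric] e' u' by simp
  finally have 1: "z \<odot> star (PG_star P) z = x (f \<cdot> star S f)" .
  have "star (PG_star P) z \<odot> z = x n \<odot> (x m \<odot> (x q \<odot> (x p \<odot> x p) \<odot> x q) \<odot> x m) \<odot> x n"
    unfolding z_def xi by simp
  also have "\<dots> = x (n \<cdot> (m \<cdot> (q \<cdot> p \<cdot> q) \<cdot> m) \<cdot> n)"
    unfolding x_idem[OF P(1)] using x_sandwich proj_sandwich P by (simp del: F.assoc assoc)
  also have "n \<cdot> (m \<cdot> (q \<cdot> p \<cdot> q) \<cdot> m) \<cdot> n = star S f \<cdot> f"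
    unfolding eu[symmetric] e' u' by simp
  finally have 2: "star (PG_star P) z \<odot> z = x (star S f \<cdot> f)" .
  have "z = xi f" using z unfolding 1 2 xi_def[of f] .
  then show ?thesis unfolding z_def .
qed

lemma idempotent_square_ends:
  assumes "idempotent_square S e f g h"
  shows "e \<in> idempotents S" "f \<in> idempotents S" "g \<in> idempotents S" "h \<in> idempotents S"
    "e \<cdot> star S e = f \<cdot> star S f" "g \<cdot> star S g = h \<cdot> star S h"
    "star S e \<cdot> e = star S g \<cdot> g" "star S f \<cdot> f = star S h \<cdot> h"
proof -
  show i: "e \<in> idempotents S" "f \<in> idempotents S" "g \<in> idempotents S" "h \<in> idempotents S"
    using assms unfolding idempotent_square_def by auto
  have "e \<in> carrier S" "f \<in> carrier S" "g \<in> carrier S" "h \<in> carrier S"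
    using i idempotent_products by auto
  then show "e \<cdot> star S e = f \<cdot> star S f" "g \<cdot> star S g = h \<cdot> star S h"
    "star S e \<cdot> e = star S g \<cdot> g" "star S f \<cdot> f = star S h \<cdot> h"
    using assms green_R_iff[of e f] green_R_iff[of g h] green_L_iff[of e g] green_L_iff[of f h]
    unfolding idempotent_square_def by auto
qed

text \<open>Both right-hand columns arise from the left-hand ones by multiplying with
  \<open>xi u\<close>, so each quotient is a projection times \<open>xi u\<close>; that projection
  is shared because \<open>e\<close> and \<open>g\<close> are \<L>-related.\<close>

lemma LR_singularised_xi:
  assumes sq: "idempotent_square S e f g h" and u: "u \<in> idempotents S" "LR_singularised S u e f g h"
  shows "star (PG_star P) (xi e) \<odot> xi f = star (PG_star P) (xi g) \<odot> xi h"
proof -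
  note s = idempotent_square_ends[OF sq]
  have f: "xi f = xi e \<odot> xi u" and h: "xi h = xi g \<odot> xi u"
    using xi_mult[OF s(1) u(1) s(2)] xi_mult[OF s(3) u(1) s(4)] u(2) unfolding LR_singularised_def by auto
  have "star (PG_star P) (xi a) \<odot> (xi a \<odot> xi u) = x (star S a \<cdot> a) \<odot> xi u" if "a \<in> idempotents S" for a
    unfolding F.arr_cancel(2)[OF xi_arr[OF that], symmetric]
    using F.arr_carrier[OF xi_arr[OF that]] F.arr_carrier[OF xi_arr[OF u(1)]]
    by (simp add: F.assoc F.star_closed)
  then show ?thesis unfolding f h using s by simp
qed

text \<open>The starred square is handled by \<open>xi_mult\<close>. This first yields an equation
  between \<open>xi e \<odot> star (PG_star P) (xi g)\<close> and its analogue for \<open>f\<close>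
  and \<open>h\<close>, which is then rearranged into the required quotients.\<close>

lemma UD_singularised_xi:
  assumes sq: "idempotent_square S e f g h" and u: "u \<in> idempotents S" "UD_singularised S u e f g h"
  shows "star (PG_star P) (xi e) \<odot> xi f = star (PG_star P) (xi g) \<odot> xi h"
proof -
  note s = idempotent_square_ends[OF sq]
  have mult: "star (PG_star P) (xi a) \<odot> star (PG_star P) (xi u) = star (PG_star P) (xi b)"
    if "a \<in> idempotents S" "b \<in> idempotents S" "a \<cdot> u = a" "u \<cdot> a = b" for a b
  proof -
    have "star S u \<cdot> star S a = star S a" "star S a \<cdot> star S u = star S b"
      using that u idempotent_products(1) star_mult by metis+
    then have "xi (star S a) \<odot> xi (star S u) = xi (star S b)"
      using that u star_idempotent by (intro xi_mult) auto
    then show ?thesis using that u by (simp add: xi_star)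
  qed
  have g: "star (PG_star P) (xi e) \<odot> star (PG_star P) (xi u) = star (PG_star P) (xi g)"
    and h: "star (PG_star P) (xi f) \<odot> star (PG_star P) (xi u) = star (PG_star P) (xi h)"
    using mult s u(2) unfolding UD_singularised_def by auto
  have c: "xi a \<in> carrier (PG_star P)" if "a \<in> idempotents S" for a
    using F.arr_carrier[OF xi_arr[OF that]] .
  note [simp] = c[OF s(1)] c[OF s(2)] c[OF s(3)] c[OF s(4)] c[OF u(1)] F.star_closed F.closed F.assoc
  have "xi a \<odot> (star (PG_star P) (xi a) \<odot> star (PG_star P) (xi u))
      = x (a \<cdot> star S a) \<odot> star (PG_star P) (xi u)" if "a \<in> idempotents S" for a
    unfolding F.arr_cancel(1)[OF xi_arr[OF that], symmetric] using c[OF that] by simp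
  then have 1: "xi e \<odot> star (PG_star P) (xi g) = xi f \<odot> star (PG_star P) (xi h)"
    unfolding g[symmetric] h[symmetric] using s by simp
  \<comment> \<open>The common end of \<open>e\<close> and \<open>g\<close> is inserted to apply the
    equation, and the common end of \<open>f\<close> and \<open>h\<close> is absorbed
    afterwards.\<close>
  have "star (PG_star P) (xi g) \<odot> xi h = (star (PG_star P) (xi e) \<odot> xi e) \<odot> star (PG_star P) (xi g) \<odot> xi h"
    using F.arr_cancel(2)[OF xi_arr[OF s(1)]] F.arr_left[OF F.arr_star[OF xi_arr[OF s(3)]]] s(7) by simp
  also have "\<dots> = star (PG_star P) (xi e) \<odot> (xi e \<odot> star (PG_star P) (xi g)) \<odot> xi h" by simp
  also have "\<dots> = star (PG_star P) (xi e) \<odot> (xi f \<odot> (star (PG_star P) (xi h) \<odot> xi h))"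
    unfolding 1 by simp
  also have "\<dots> = star (PG_star P) (xi e) \<odot> xi f"
    using F.arr_cancel(2)[OF xi_arr[OF s(4)]] F.arr_right[OF xi_arr[OF s(2)]] s(8) by simp
  finally show ?thesis by simp
qed

text \<open>Swapping rows interchanges the two sides of the equation, and swapping columns replaces
  both sides by their stars.\<close>

lemma singular_square_xi:
  assumes "singular_square S e f g h"
  shows "star (PG_star P) (xi e) \<odot> xi f = star (PG_star P) (xi g) \<odot> xi h"
proof -
  obtain u where sq: "idempotent_square S e f g h" and u: "u \<in> idempotents S"
    and cases: "LR_singularised S u e f g h \<or> LR_singularised S u f e h g \<or>
        UD_singularised S u e f g h \<or> UD_singularised S u g h e f"
    using assms unfolding singular_square_def by blast
  note s = idempotent_square_ends[OF sq]
  have swap: "idempotent_square S f e h g" "idempotent_square S g h e f"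
    using sq unfolding idempotent_square_def green_R_def green_L_def by auto
  have c: "xi a \<in> carrier (PG_star P)" if "a \<in> idempotents S" for a
    using F.arr_carrier[OF xi_arr[OF that]] .
  have "star (PG_star P) (xi e) \<odot> xi f = star (PG_star P) (xi g) \<odot> xi h"
    if "star (PG_star P) (xi f) \<odot> xi e = star (PG_star P) (xi h) \<odot> xi g"
    using arg_cong[OF that, of "star (PG_star P)"] c s(1-4) by (simp add: F.star_mult F.star_closed F.star_star)
  then show ?thesis
    using cases LR_singularised_xi[OF sq u] LR_singularised_xi[OF swap(1) u]
      UD_singularised_xi[OF sq u] UD_singularised_xi[OF swap(2) u] by (elim disjE) simp_all
qed

end

section \<open>The action on the presented group\<close>

locale pg_subgroup = proj_alg_of_semigroup S P
  for S :: "'a star_semigrp" (structure) and P :: "'a proj_alg" +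
  fixes p\<^sub>0 :: 'a and D T :: "'a set"
  assumes p0: "p\<^sub>0 \<in> carrier P"
    and D: "D = green_D S `` {p\<^sub>0}"
    and tree: "GH_spanning_tree S D T"
begin

definition ED :: "'a set" where
  "ED = idempotents S \<inter> D"

definition rels :: "('a gword \<times> 'a gword) set" where
  "rels = {(gen e, []) | e. e \<in> T} \<union>
       {(gen_inv (e \<cdot> star S e) @ gen e, gen_inv (star S e) @ gen (star S e \<cdot> e)) | e. e \<in> ED} \<union>
       {(gen_inv e @ gen f, gen_inv g @ gen h) | e f g h.
          singular_square S e f g h \<and> {e, f, g, h} \<subseteq> D}"

definition PD :: "'a set" where
  "PD = {p \<in> projections S. \<exists>c. arr p\<^sub>0 c p}"

abbreviation GP :: "'a gword set monoid" where
  "GP \<equiv> group_presentation ED rels"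

sublocale pres: group_pres ED rels .

sublocale G: group GP
  by (rule pres.group_grp)

abbreviation ag :: "'a \<Rightarrow> 'a gword set" where
  "ag \<equiv> pres.agen"

section \<open>Projections and idempotents of \<open>D\<close>, and the relations of the presented
  group\<close>

lemma p0_proj: "p\<^sub>0 \<in> projections S"
  using p0 carrier_P by simp

lemma PD_proj: "p \<in> PD \<Longrightarrow> p \<in> projections S"
  unfolding PD_def by simp

lemma p0_PD: "p\<^sub>0 \<in> PD"
  unfolding PD_def using p0_proj arr_id by blast

lemma PD_arr: "arr p a q \<Longrightarrow> p \<in> PD \<Longrightarrow> q \<in> PD"
  unfolding PD_def using arr_comp arr_proj by blast

lemma PD_friendly: "friendly p q \<Longrightarrow> p \<in> PD \<Longrightarrow> q \<in> PD"
  using PD_arr friendly_arr by blast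

lemma D_iff: "a \<in> D \<longleftrightarrow> a \<in> carrier S \<and> star S a \<cdot> a \<in> PD"
proof (cases "a \<in> carrier S")
  case True
  then show ?thesis
    unfolding D PD_def using green_D_iff[OF proj_carrier[OF p0_proj] True] p0_proj
    by (simp add: proj_star proj_idem proj_rproj)
next
  case False
  then show ?thesis unfolding D green_D_def green_L_def by auto
qed

lemma arr_D: "arr p a q \<Longrightarrow> p \<in> PD \<Longrightarrow> a \<in> D"
  using PD_arr arr_cancel(2) arr_carrier unfolding D_iff by metis

lemma D_ends: "a \<in> D \<Longrightarrow> a \<cdot> star S a \<in> PD \<and> star S a \<cdot> a \<in> PD"
  using PD_arr[OF arr_star[OF arr_self]] unfolding D_iff by blast

lemma ED_friendly:
  assumes "e \<in> ED"
  shows "friendly (e \<cdot> star S e) (star S e \<cdot> e)" "e \<cdot> star S e \<in> PD" "star S e \<cdot> e \<in> PD"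
    "(e \<cdot> star S e) \<cdot> (star S e \<cdot> e) = e"
  using assms idempotent_friendly idempotent_products(2)[symmetric] D_ends unfolding ED_def by auto

lemma friendly_ED: "friendly p q \<Longrightarrow> p \<in> PD \<Longrightarrow> p \<cdot> q \<in> ED"
  unfolding ED_def using friendly_idempotent arr_D friendly_arr by blast

lemma PD_ED: "p \<in> PD \<Longrightarrow> p \<in> ED"
  using friendly_ED[OF friendly_refl] PD_proj proj_idem by metis

lemma ED_cases:
  assumes "e \<in> ED"
  obtains p q where "friendly p q" "p \<in> PD" "q \<in> PD" "e = p \<cdot> q" "e \<cdot> star S e = p" "star S e \<cdot> e = q"
  using ED_friendly[OF assms] by metis

lemma T_ED: "T \<subseteq> ED"
  using tree unfolding GH_spanning_tree_def ED_def by auto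

lemma ag_closed [simp]: "e \<in> ED \<Longrightarrow> ag e \<in> carrier GP"
  by (rule pres.agen_closed)

lemma ag_T:
  assumes "e \<in> T" shows "ag e = \<one>\<^bsub>GP\<^esub>"
proof -
  have "(gen e, []) \<in> rels" using assms unfolding rels_def by blast
  then show ?thesis unfolding pres.agen_def pres.one_grp using assms T_ED by (intro pres.gcls_rel) auto
qed

lemma ag_rel:
  assumes "(gen_inv a @ gen b, gen_inv c @ gen d) \<in> rels" "a \<in> ED" "b \<in> ED" "c \<in> ED" "d \<in> ED"
  shows "inv\<^bsub>GP\<^esub> ag a \<otimes>\<^bsub>GP\<^esub> ag b = inv\<^bsub>GP\<^esub> ag c \<otimes>\<^bsub>GP\<^esub> ag d"
proof -
  have "pres.gcls (gen_inv a @ gen b) = pres.gcls (gen_inv c @ gen d)"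
    using assms by (intro pres.gcls_rel) auto
  moreover have "pres.gcls (gen_inv a @ gen b) = inv\<^bsub>GP\<^esub> ag a \<otimes>\<^bsub>GP\<^esub> ag b" if "a \<in> ED" "b \<in> ED" for a b
    using that pres.mult_gcls[of "gen_inv a" "gen b"] by (simp add: pres.gcls_gen_inv pres.agen_def)
  ultimately show ?thesis using assms by metis
qed

text \<open>The weight of the right multiplication by the idempotent \<open>p \<cdot> q\<close>, which takes the \<open>\<L>\<close>-class
  of \<open>p\<close> to that of \<open>q\<close>.\<close>

definition bw :: "'a \<Rightarrow> 'a \<Rightarrow> 'a gword set" where
  "bw p q = inv\<^bsub>GP\<^esub> ag p \<otimes>\<^bsub>GP\<^esub> ag (p \<cdot> q)"

lemma bw_closed: "friendly p q \<Longrightarrow> p \<in> PD \<Longrightarrow> bw p q \<in> carrier GP"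
  unfolding bw_def using friendly_ED PD_ED by simp

lemma bw_id: "p \<in> PD \<Longrightarrow> bw p p = \<one>\<^bsub>GP\<^esub>"
  unfolding bw_def using PD_ED PD_proj proj_idem G.l_inv by simp

text \<open>The relation for \<open>e = p \<cdot> q\<close> equates \<open>bw p q\<close> with the
  product of the inverse of \<open>ag (q \<cdot> p)\<close> and \<open>ag q\<close>, which is the
  inverse of \<open>bw q p\<close>.\<close>

lemma bw_inv:
  assumes "friendly p q" "p \<in> PD"
  shows "bw q p = inv\<^bsub>GP\<^esub> bw p q"
proof -
  note q = PD_friendly[OF assms] and f = assms(1) friendly_sym[OF assms(1)]
  note ED = friendly_ED[OF f(1) assms(2)] friendly_ED[OF f(2) q] PD_ED[OF assms(2)] PD_ED[OF q]
  have "(gen_inv p @ gen (p \<cdot> q), gen_inv (q \<cdot> p) @ gen q) \<in> rels"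
    using ED(1) arr_cancel[OF friendly_arr[OF f(1)]] friendly_star[OF f(1)] unfolding rels_def by force
  from ag_rel[OF this ED(3,1,2,4)] have "bw p q = inv\<^bsub>GP\<^esub> ag (q \<cdot> p) \<otimes>\<^bsub>GP\<^esub> ag q"
    unfolding bw_def .
  then show ?thesis unfolding bw_def[of q p] using ED by (simp add: G.inv_mult_group)
qed

text \<open>The square with rows \<open>q t, q v\<close> and \<open>v t, v\<close> is singularised by \<open>r\<close>.\<close>

lemma bw_singular:
  assumes qt: "friendly q t" and qv: "friendly q v" and q: "q \<in> PD" and r: "r \<in> projections S"
    and qr: "q \<cdot> r = q" and trt: "t \<cdot> r \<cdot> t = t" and v: "v = r \<cdot> t \<cdot> r"
  shows "bw q t \<otimes>\<^bsub>GP\<^esub> bw t v = bw q v"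
proof -
  have t: "t \<in> PD" and v': "v \<in> PD" using PD_friendly qt qv q by auto
  note [simp] = proj_simps PD_proj[OF q] PD_proj[OF t] PD_proj[OF v'] r
  have tv: "friendly t v" using friendly_sandwich(1)[OF PD_proj[OF t] r trt] v by simp
  have vt: "friendly v t" using friendly_sym[OF tv] .
  have vv: "friendly v v" using friendly_refl by simp
  have rq: "r \<cdot> q = q" using qr by (metis proj_carrier proj_star star_mult r PD_proj[OF q])
  have rv: "r \<cdot> v = v" "v \<cdot> r = v" unfolding v by simp_all
  note a = friendly_arr[OF qt] friendly_arr[OF qv] friendly_arr[OF vt] friendly_arr[OF vv]
  have sq: "idempotent_square S (q \<cdot> t) (q \<cdot> v) (v \<cdot> t) v"
    unfolding idempotent_square_def
    using friendly_idempotent[OF qt] friendly_idempotent[OF qv] friendly_idempotent[OF vt]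
      friendly_idempotent[OF vv] arr_cancel[OF a(1)] arr_cancel[OF a(2)] arr_cancel[OF a(3)]
      arr_cancel[OF a(4)] arr_carrier[OF a(1)] arr_carrier[OF a(2)] arr_carrier[OF a(3)]
    by (simp add: green_R_iff green_L_iff del: assoc star_mult)
  have qtr: "q \<cdot> t \<cdot> r = q \<cdot> v"
  proof -
    have "q \<cdot> v = (q \<cdot> r) \<cdot> t \<cdot> r" unfolding v by simp
    then show ?thesis by (simp only: qr)
  qed
  have vtr: "v \<cdot> t \<cdot> r = v"
  proof -
    have "v \<cdot> t \<cdot> r = r \<cdot> (t \<cdot> r \<cdot> t) \<cdot> r" unfolding v by simp
    then show ?thesis unfolding trt v .
  qed
  have r_idem: "r \<in> idempotents S" unfolding idempotents_def by simp
  have "LR_singularised S r (q \<cdot> t) (q \<cdot> v) (v \<cdot> t) v"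
    unfolding LR_singularised_def using rq rv qtr vtr by (metis assoc proj_carrier r PD_proj q t v')
  then have "singular_square S (q \<cdot> t) (q \<cdot> v) (v \<cdot> t) v"
    unfolding singular_square_def using sq r_idem by blast
  moreover note ED = friendly_ED[OF qt q] friendly_ED[OF qv q] friendly_ED[OF vt v'] PD_ED[OF v'] PD_ED[OF q]
  ultimately have "(gen_inv (q \<cdot> t) @ gen (q \<cdot> v), gen_inv (v \<cdot> t) @ gen v) \<in> rels"
    unfolding rels_def ED_def by blast
  note rel = ag_rel[OF this ED(1-4)]
  \<comment> \<open>Inverting \<open>bw v t\<close> writes \<open>bw t v\<close> as the quotient in
    the lower row of the square; exchanged for the upper row, it makes the product
    telescope.\<close>
  have "bw t v = inv\<^bsub>GP\<^esub> ag (v \<cdot> t) \<otimes>\<^bsub>GP\<^esub> ag v"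
    unfolding bw_inv[OF vt v'] unfolding bw_def using ED by (simp add: G.inv_mult_group)
  also have "\<dots> = inv\<^bsub>GP\<^esub> ag (q \<cdot> t) \<otimes>\<^bsub>GP\<^esub> ag (q \<cdot> v)" using rel by simp
  finally show ?thesis
    unfolding bw_def[of q] using ED by (simp add: G.m_assoc) (simp add: G.m_assoc[symmetric])
qed

text \<open>Partial right action of the generators of \<open>PG(P)\<close> on pairs of an \<open>\<L>\<close>-class of \<open>D\<close> and an
  element of the presented group; the state \<open>None\<close> stands for having left the \<open>\<R>\<close>-class.\<close>

type_synonym 'b state = "('b \<times> 'b gword set) option"

definition act :: "'a state \<Rightarrow> 'a \<Rightarrow> 'a state" where
  "act s r = (case s of None \<Rightarrow> None
    | Some (p, g) \<Rightarrow> if p \<cdot> r \<cdot> p = p then Some (r \<cdot> p \<cdot> r, g \<otimes>\<^bsub>GP\<^esub> bw p (r \<cdot> p \<cdot> r)) else None)"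

definition states :: "'a state set" where
  "states = insert None (Some ` (PD \<times> carrier GP))"

lemma act_None: "act None r = None"
  unfolding act_def by simp

lemma act_Some: "act (Some (p, g)) r =
    (if p \<cdot> r \<cdot> p = p then Some (r \<cdot> p \<cdot> r, g \<otimes>\<^bsub>GP\<^esub> bw p (r \<cdot> p \<cdot> r)) else None)"
  unfolding act_def by simp

lemma PD_sandwich:
  assumes "p \<in> PD" "r \<in> projections S" "p \<cdot> r \<cdot> p = p"
  shows "friendly p (r \<cdot> p \<cdot> r)" "r \<cdot> p \<cdot> r \<in> PD"
  using friendly_sandwich(1)[OF PD_proj[OF assms(1)] assms(2,3)] PD_friendly assms(1) by blast+

lemma act_closed: "s \<in> states \<Longrightarrow> r \<in> projections S \<Longrightarrow> act s r \<in> states"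
  unfolding states_def by (auto simp: act_None act_Some PD_sandwich bw_closed)

text \<open>After the first \<open>r\<close> the state sits at a projection fixed by
  \<open>r\<close>, and staying there has trivial weight.\<close>

lemma act_idem:
  assumes "s \<in> states" "r \<in> projections S"
  shows "act (act s r) r = act s r"
proof (cases s)
  case (Some pg)
  obtain p g where s: "s = Some (p, g)" "p \<in> PD" "g \<in> carrier GP"
    using assms Some unfolding states_def by auto
  note [simp] = proj_simps assms(2) PD_proj[OF s(2)]
  show ?thesis
  proof (cases "p \<cdot> r \<cdot> p = p")
    case True
    define q where "q = r \<cdot> p \<cdot> r"
    note q = PD_sandwich[OF s(2) assms(2) True, folded q_def]
    have "q \<cdot> r \<cdot> q = r \<cdot> (p \<cdot> r \<cdot> p) \<cdot> r" "r \<cdot> q \<cdot> r = q" unfolding q_def by simp_all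
    then have "q \<cdot> r \<cdot> q = q" "r \<cdot> q \<cdot> r = q" unfolding True q_def by simp_all
    then show ?thesis
      using True s q by (simp add: act_Some q_def[symmetric] bw_id bw_closed del: assoc)
  qed (simp add: s act_Some act_None)
qed (simp add: act_None)

text \<open>With \<open>t = s \<cdot> q \<cdot> s\<close>, the element \<open>t \<cdot> r\<close> is
  a prefix of \<open>t \<cdot> r \<cdot> (q \<cdot> t) = t\<close>, so \<open>arr_prefix\<close>
  applies. Hence, after \<open>r\<close> and then \<open>s\<close>, reading \<open>r\<close> again
  is always defined.\<close>

lemma sandwich_back:
  assumes q: "q \<in> PD" and r: "r \<in> projections S" and s: "s \<in> projections S"
    and rq: "r \<cdot> q = q" and qsq: "q \<cdot> s \<cdot> q = q"
  shows "(s \<cdot> q \<cdot> s) \<cdot> r \<cdot> (s \<cdot> q \<cdot> s) = s \<cdot> q \<cdot> s"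
proof -
  define t where "t = s \<cdot> q \<cdot> s"
  note f = PD_sandwich[OF q s qsq, folded t_def]
  have P: "q \<in> projections S" "t \<in> projections S" using q f PD_proj by auto
  note [simp] = proj_simps r P
  have "t \<cdot> r \<cdot> (q \<cdot> t) = t \<cdot> (r \<cdot> q) \<cdot> t" by simp
  also have "\<dots> = t" using f(1) unfolding rq friendly_def by simp
  finally have "arr t (t \<cdot> r \<cdot> (q \<cdot> t)) t" using arr_id P by simp
  then have "(t \<cdot> r) \<cdot> star S (t \<cdot> r) = t" by (rule arr_prefix) simp_all
  then show ?thesis unfolding t_def[symmetric] by simp
qed

text \<open>The word \<open>r s r\<close> leads from \<open>p\<close> through \<open>q\<close> and
  \<open>t\<close> to \<open>v\<close>, while the single letter goes from \<open>p\<close> to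
  \<open>v\<close> directly. Two uses of \<open>bw_singular\<close> contract the three weights to
  \<open>bw p v\<close>.\<close>

lemma act_sandwich:
  assumes st: "st \<in> states" and r: "r \<in> projections S" and s: "s \<in> projections S"
  shows "act (act (act st r) s) r = act st (r \<cdot> s \<cdot> r)"
proof (cases st)
  case (Some pg)
  obtain p g where st': "st = Some (p, g)" "p \<in> PD" "g \<in> carrier GP"
    using assms Some unfolding states_def by auto
  note [simp] = proj_simps r s PD_proj[OF st'(2)]
  show ?thesis
  proof (cases "p \<cdot> r \<cdot> p = p")
    case prp: True
    define q where "q = r \<cdot> p \<cdot> r"
    note q = PD_sandwich[OF st'(2) r prp, folded q_def]
    note [simp] = PD_proj[OF q(2)]
    have rq: "r \<cdot> q = q" "q \<cdot> r = q" unfolding q_def by simp_all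
    have q1: "q \<cdot> s \<cdot> q = r \<cdot> (p \<cdot> (r \<cdot> s \<cdot> r) \<cdot> p) \<cdot> r" unfolding q_def by simp
    have "p \<cdot> q \<cdot> p = (p \<cdot> r \<cdot> p) \<cdot> (r \<cdot> p)" unfolding q_def by simp
    then have pqp: "p \<cdot> q \<cdot> p = p" unfolding prp using prp by simp
    have "p \<cdot> (q \<cdot> s \<cdot> q) \<cdot> p = (p \<cdot> r \<cdot> p) \<cdot> (r \<cdot> s \<cdot> r) \<cdot> (p \<cdot> r \<cdot> p)"
      unfolding q_def by simp
    then have p1: "p \<cdot> (q \<cdot> s \<cdot> q) \<cdot> p = p \<cdot> (r \<cdot> s \<cdot> r) \<cdot> p" unfolding prp .
    \<comment> \<open>Once the first \<open>r\<close> is defined, the rest of the word is defined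
      exactly when the single letter is.\<close>
    have iff: "q \<cdot> s \<cdot> q = q \<longleftrightarrow> p \<cdot> (r \<cdot> s \<cdot> r) \<cdot> p = p"
      using q1 p1 pqp unfolding q_def[symmetric] by (metis q_def)
    show ?thesis
    proof (cases "q \<cdot> s \<cdot> q = q")
      case qsq: True
      define t where "t = s \<cdot> q \<cdot> s"
      define v where "v = r \<cdot> t \<cdot> r"
      note t = PD_sandwich[OF q(2) s qsq, folded t_def]
      note [simp] = PD_proj[OF t(2)]
      have trt: "t \<cdot> r \<cdot> t = t" using sandwich_back[OF q(2) r s rq(1) qsq] unfolding t_def .
      note v = PD_sandwich[OF t(2) r trt, folded v_def]
      have prsr: "p \<cdot> (r \<cdot> s \<cdot> r) \<cdot> p = p" using iff qsq by simp
      have rsr: "r \<cdot> s \<cdot> r \<in> projections S" using proj_sandwich by simp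
      have v1: "v = (r \<cdot> s \<cdot> r) \<cdot> p \<cdot> (r \<cdot> s \<cdot> r)" unfolding v_def t_def q_def by simp
      have v2: "v = (r \<cdot> s \<cdot> r) \<cdot> q \<cdot> (r \<cdot> s \<cdot> r)" unfolding v1 q_def by simp
      have pv: "friendly p v" using PD_sandwich[OF st'(2) rsr prsr] v1 by simp
      have "q \<cdot> (r \<cdot> s \<cdot> r) \<cdot> q = (q \<cdot> r) \<cdot> s \<cdot> (r \<cdot> q)" by simp
      then have "q \<cdot> (r \<cdot> s \<cdot> r) \<cdot> q = q" unfolding rq qsq .
      then have qv: "friendly q v" using PD_sandwich[OF q(2) rsr] v2 by simp
      have vr: "v \<cdot> r = v" unfolding v_def by simp
      have b1: "bw q t \<otimes>\<^bsub>GP\<^esub> bw t v = bw q v"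
        by (rule bw_singular[OF t(1) qv q(2) r rq(2) trt v_def])
      \<comment> \<open>\<open>bw_singular\<close> requires its first vertex to be fixed by
        \<open>r\<close>. This holds for \<open>v\<close>, so the triangle is read from
        \<open>v\<close> and then inverted.\<close>
      have "bw v p \<otimes>\<^bsub>GP\<^esub> bw p q = bw v q"
        by (rule bw_singular[OF friendly_sym[OF pv] friendly_sym[OF qv] v(2) r vr prp q_def])
      then have "inv\<^bsub>GP\<^esub> bw p v \<otimes>\<^bsub>GP\<^esub> bw p q = inv\<^bsub>GP\<^esub> bw q v"
        using bw_inv pv qv st'(2) q(2) by simp
      then have "bw q v = inv\<^bsub>GP\<^esub> (inv\<^bsub>GP\<^esub> bw p v \<otimes>\<^bsub>GP\<^esub> bw p q)"
        using bw_closed[OF qv q(2)] by simp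
      also have "\<dots> = inv\<^bsub>GP\<^esub> bw p q \<otimes>\<^bsub>GP\<^esub> bw p v"
        using bw_closed[OF pv st'(2)] bw_closed[OF q(1) st'(2)] by (simp add: G.inv_mult_group)
      finally have b2: "bw p q \<otimes>\<^bsub>GP\<^esub> bw q v = bw p v"
        using bw_closed[OF pv st'(2)] bw_closed[OF q(1) st'(2)] by (simp add: G.m_assoc[symmetric])
      note bc = bw_closed[OF pv st'(2)] bw_closed[OF q(1) st'(2)] bw_closed[OF qv q(2)]
        bw_closed[OF t(1) q(2)] bw_closed[OF v(1) t(2)] st'(3)
      have "act (act (act st r) s) r
          = Some (v, g \<otimes>\<^bsub>GP\<^esub> bw p q \<otimes>\<^bsub>GP\<^esub> bw q t \<otimes>\<^bsub>GP\<^esub> bw t v)"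
        using prp qsq trt by (simp add: st' act_Some q_def[symmetric] t_def[symmetric] v_def[symmetric] del: assoc)
      also have "g \<otimes>\<^bsub>GP\<^esub> bw p q \<otimes>\<^bsub>GP\<^esub> bw q t \<otimes>\<^bsub>GP\<^esub> bw t v
          = g \<otimes>\<^bsub>GP\<^esub> (bw p q \<otimes>\<^bsub>GP\<^esub> (bw q t \<otimes>\<^bsub>GP\<^esub> bw t v))"
        using bc by (simp add: G.m_assoc)
      also have "\<dots> = g \<otimes>\<^bsub>GP\<^esub> bw p v" unfolding b1 b2 ..
      also have "Some (v, \<dots>) = act st (r \<cdot> s \<cdot> r)"
        using prsr by (simp add: st' act_Some v1[symmetric] del: assoc)
      finally show ?thesis .
    next
      case False
      then show ?thesis using iff prp by (simp add: st' act_Some act_None q_def[symmetric] del: assoc)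
    qed
  next
    case False
    \<comment> \<open>Otherwise \<open>p \<cdot> r\<close> would be a prefix of a loop at
      \<open>p\<close>, and the letter \<open>r\<close> would already be defined at
      \<open>p\<close>.\<close>
    have "p \<cdot> (r \<cdot> s \<cdot> r) \<cdot> p \<noteq> p"
    proof
      assume *: "p \<cdot> (r \<cdot> s \<cdot> r) \<cdot> p = p"
      then have "arr p ((p \<cdot> r) \<cdot> (s \<cdot> r \<cdot> p)) p" using arr_id[of p] by simp
      then have "(p \<cdot> r) \<cdot> star S (p \<cdot> r) = p" by (rule arr_prefix) simp_all
      then show False using False by simp
    qed
    then show ?thesis using False by (simp add: st' act_Some act_None del: assoc)
  qed
qed (simp add: act_None)

text \<open>The second \<open>r\<close> leads from \<open>t\<close> to \<open>v\<close>, and the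
  second \<open>s\<close> leads back to \<open>t\<close> because products of two projections are
  idempotent. The weights of these two moves cancel by \<open>bw_inv\<close>.\<close>

lemma act_square:
  assumes st: "st \<in> states" and r: "r \<in> projections S" and s: "s \<in> projections S"
  shows "act (act (act (act st r) s) r) s = act (act st r) s"
proof (cases "act st r")
  case None
  then show ?thesis by (simp add: act_None)
next
  case (Some qg)
  then obtain p g where st': "st = Some (p, g)" "p \<in> PD" "g \<in> carrier GP" "p \<cdot> r \<cdot> p = p"
    using st unfolding states_def by (auto simp: act_None act_Some split: if_splits)
  note [simp] = proj_simps r s PD_proj[OF st'(2)]
  define q where "q = r \<cdot> p \<cdot> r"
  note q = PD_sandwich[OF st'(2) r st'(4), folded q_def]
  note [simp] = PD_proj[OF q(2)]
  have rq: "r \<cdot> q = q" "q \<cdot> r = q" unfolding q_def by simp_all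
  define g' where "g' = g \<otimes>\<^bsub>GP\<^esub> bw p q"
  have g': "g' \<in> carrier GP" unfolding g'_def using st' bw_closed[OF q(1)] by simp
  have st1: "act st r = Some (q, g')"
    using st'(4) by (simp add: st'(1) act_Some q_def[symmetric] g'_def del: assoc)
  show ?thesis
  proof (cases "q \<cdot> s \<cdot> q = q")
    case qsq: True
    define t where "t = s \<cdot> q \<cdot> s"
    define v where "v = r \<cdot> t \<cdot> r"
    note t = PD_sandwich[OF q(2) s qsq, folded t_def]
    note [simp] = PD_proj[OF t(2)]
    have trt: "t \<cdot> r \<cdot> t = t" using sandwich_back[OF q(2) r s rq(1) qsq] unfolding t_def .
    note v = PD_sandwich[OF t(2) r trt, folded v_def]
    note [simp] = PD_proj[OF v(2)]
    have ts: "t \<cdot> s = t" "s \<cdot> t = t" unfolding t_def by simp_all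
    have srsr: "s \<cdot> (r \<cdot> (s \<cdot> (r \<cdot> a))) = s \<cdot> (r \<cdot> a)" if "a \<in> carrier S" for a
    proof -
      have "s \<cdot> (r \<cdot> (s \<cdot> (r \<cdot> a))) = ((s \<cdot> r) \<cdot> star S (s \<cdot> r) \<cdot> (s \<cdot> r)) \<cdot> a"
        using that by simp
      also have "\<dots> = s \<cdot> (r \<cdot> a)" by (subst regular) (use that in simp_all)
      finally show ?thesis .
    qed
    have vsv: "v \<cdot> s \<cdot> v = v"
    proof -
      have "v \<cdot> s \<cdot> v = r \<cdot> (t \<cdot> s) \<cdot> r \<cdot> s \<cdot> r \<cdot> (s \<cdot> t) \<cdot> r" unfolding ts v_def by simp
      also have "\<dots> = r \<cdot> (t \<cdot> s) \<cdot> r \<cdot> (s \<cdot> t) \<cdot> r" by (simp add: srsr)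
      also have "\<dots> = r \<cdot> (t \<cdot> r \<cdot> t) \<cdot> r" unfolding ts by simp
      finally show ?thesis unfolding trt v_def .
    qed
    have svs: "s \<cdot> v \<cdot> s = t"
    proof -
      have "s \<cdot> v \<cdot> s = s \<cdot> r \<cdot> (s \<cdot> (r \<cdot> q) \<cdot> s) \<cdot> r \<cdot> s" unfolding v_def t_def rq by simp
      also have "\<dots> = ((s \<cdot> r) \<cdot> star S (s \<cdot> r) \<cdot> (s \<cdot> r)) \<cdot> (q \<cdot> r) \<cdot> s \<cdot> r \<cdot> s" by (simp add: rq)
      also have "\<dots> = (s \<cdot> r) \<cdot> q \<cdot> ((r \<cdot> s) \<cdot> star S (r \<cdot> s) \<cdot> (r \<cdot> s))"
        by (subst regular) simp_all
      also have "\<dots> = s \<cdot> (r \<cdot> q \<cdot> r) \<cdot> s" by (subst regular) simp_all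
      finally show ?thesis unfolding rq t_def .
    qed
    have b: "bw v t = inv\<^bsub>GP\<^esub> bw t v" by (rule bw_inv[OF v(1) t(2)])
    define h where "h = g' \<otimes>\<^bsub>GP\<^esub> bw q t"
    have h: "h \<in> carrier GP" unfolding h_def using g' bw_closed[OF t(1) q(2)] by simp
    have "act (act (act (act st r) s) r) s = Some (t, h \<otimes>\<^bsub>GP\<^esub> bw t v \<otimes>\<^bsub>GP\<^esub> bw v t)"
      using qsq trt vsv svs
      by (simp add: st1 act_Some t_def[symmetric] v_def[symmetric] h_def del: assoc)
    also have "h \<otimes>\<^bsub>GP\<^esub> bw t v \<otimes>\<^bsub>GP\<^esub> bw v t = h"
      unfolding b using h bw_closed[OF v(1) t(2)] by (simp add: G.m_assoc)
    also have "Some (t, h) = act (act st r) s"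
      using qsq by (simp add: st1 act_Some t_def[symmetric] h_def del: assoc)
    finally show ?thesis .
  next
    case False
    then show ?thesis by (simp add: st1 act_Some act_None)
  qed
qed

lemma foldl_act_cong:
  assumes "(u, v) \<in> word_cong (projections S) (PG_rels P)" "s \<in> states"
  shows "foldl act s u = foldl act s v"
  using assms
proof (rule foldl_word_cong[where X = states])
  fix s u v assume "(u, v) \<in> PG_rels P" and s: "s \<in> states"
  then show "foldl act s u = foldl act s v"
  proof (cases rule: PG_rels_cases)
    case (square p q)
    then show ?thesis using act_square s by simp
  qed (auto simp: act_idem act_sandwich s)
qed (auto intro: act_closed)

end

section \<open>The isomorphism\<close>

context pg_subgroup
begin

text \<open>For a start in \<open>states\<close>, \<open>foldl_act_cong\<close> makes the choice of
  the representative immaterial.\<close>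

definition Act :: "'a state \<Rightarrow> 'a list set \<Rightarrow> 'a state" where
  "Act s X = foldl act s (SOME w. w \<in> X)"

lemma Act_pcls:
  assumes "s \<in> states" "w \<in> lists (projections S)"
  shows "Act s (pcls w) = foldl act s w"
proof -
  have "w \<in> pcls w" using assms(2) unfolding pcls_def carrier_P by (simp add: word_cong.refl)
  then have "(SOME w'. w' \<in> pcls w) \<in> pcls w" by (rule someI)
  then show ?thesis
    using foldl_act_cong[OF _ assms(1)] unfolding Act_def pcls_def carrier_P by fastforce
qed

lemma foldl_act_closed: "w \<in> lists (projections S) \<Longrightarrow> s \<in> states \<Longrightarrow> foldl act s w \<in> states"
  by (induction w arbitrary: s rule: list.induct) (simp_all add: act_closed)

lemma Act_mult:
  assumes "s \<in> states" "X \<in> carrier (PG_star P)" "Y \<in> carrier (PG_star P)"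
  shows "Act s (X \<odot> Y) = Act (Act s X) Y"
proof -
  obtain u v where "X = pcls u" "u \<in> lists (projections S)" "Y = pcls v" "v \<in> lists (projections S)"
    using assms(2,3) unfolding carrier_PG_star by blast
  then show ?thesis using assms(1) foldl_act_closed by (simp add: Act_pcls pcls_mult)
qed

lemma Act_x: "s \<in> states \<Longrightarrow> r \<in> projections S \<Longrightarrow> Act s (x r) = act s r"
  unfolding x_pcls by (simp add: Act_pcls)

lemma Some_states [simp]: "Some (p, g) \<in> states \<longleftrightarrow> p \<in> PD \<and> g \<in> carrier GP"
  unfolding states_def by auto

text \<open>Letters multiply the group component on the right only, so the action commutes with left
  translation.\<close>

lemma Act_translate:
  assumes "p \<in> PD" "g \<in> carrier GP" "h \<in> carrier GP" "X \<in> carrier (PG_star P)"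
  shows "Act (Some (p, g \<otimes>\<^bsub>GP\<^esub> h)) X = map_option (apsnd ((\<otimes>\<^bsub>GP\<^esub>) g)) (Act (Some (p, h)) X)"
  using assms(4,1,3)
proof (induction arbitrary: p h rule: PG_star_induct)
  case (gen r)
  then show ?case using assms(2) by (auto simp: Act_x act_Some G.m_assoc bw_closed PD_sandwich)
next
  case (mult r z)
  show ?case
  proof (cases "p \<cdot> r \<cdot> p = p")
    case True
    note q = PD_sandwich[OF mult.prems(1) mult.hyps(1) True]
    note b = bw_closed[OF q(1) mult.prems(1)]
    show ?thesis
      using True mult.IH[OF q(2), of "h \<otimes>\<^bsub>GP\<^esub> bw p (r \<cdot> p \<cdot> r)"] mult.prems mult.hyps assms(2) b
      by (simp add: Act_mult Act_x act_Some x_closed G.m_assoc)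
  next
    case False
    obtain w where w: "z = pcls w" "w \<in> lists (projections S)"
      using mult.hyps(2) unfolding carrier_PG_star by blast
    have "foldl act None w = None" for w by (induction w) (simp_all add: act_None)
    then have "Act None z = None" using w by (simp add: Act_pcls states_def)
    then show ?thesis
      using False mult.prems mult.hyps assms(2) by (simp add: Act_mult Act_x act_Some x_closed)
  qed
qed

lemma Act_weight:
  assumes "p \<in> PD" "g \<in> carrier GP" "X \<in> carrier (PG_star P)" "Act (Some (p, \<one>\<^bsub>GP\<^esub>)) X = Some (q, h)"
  shows "Act (Some (p, g)) X = Some (q, g \<otimes>\<^bsub>GP\<^esub> h)"
  using Act_translate[OF assms(1,2) G.one_closed assms(3)] assms(2,4) by simp

lemma Act_friendly:
  assumes "friendly p q" "p \<in> PD" "g \<in> carrier GP"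
  shows "Act (Some (p, g)) (x q) = Some (q, g \<otimes>\<^bsub>GP\<^esub> bw p q)"
  using assms unfolding friendly_def by (simp add: Act_x act_Some)

section \<open>The maximal subgroup as the group of loops at \<open>x p\<^sub>0\<close>\<close>

abbreviation H :: "'a list set monoid" where
  "H \<equiv> maximal_subgroup (PG_star P) (x p\<^sub>0)"

lemma carrier_H: "X \<in> carrier H \<longleftrightarrow> F.arr (x p\<^sub>0) X (x p\<^sub>0)"
proof (cases "X \<in> carrier (PG_star P)")
  case True
  then show ?thesis
    using F.green_R_iff[OF x_closed[OF p0_proj] True] F.green_L_iff[OF x_closed[OF p0_proj] True] p0_proj
    unfolding maximal_subgroup_def green_H_def F.arr_def by (auto simp: x_star x_idem)
next
  case False
  then show ?thesis unfolding maximal_subgroup_def green_H_def green_R_def F.arr_def by auto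
qed

lemma mult_H: "X \<otimes>\<^bsub>H\<^esub> Y = X \<odot> Y"
  unfolding maximal_subgroup_def by simp

lemma one_H: "\<one>\<^bsub>H\<^esub> = x p\<^sub>0"
  unfolding maximal_subgroup_def by simp

lemma group_H: "group H"
proof (rule groupI)
  show "\<exists>Y\<in>carrier H. Y \<otimes>\<^bsub>H\<^esub> X = \<one>\<^bsub>H\<^esub>" if "X \<in> carrier H" for X
    using that F.arr_star F.arr_cancel(2) unfolding carrier_H mult_H one_H Bex_def by blast
qed (simp_all add: carrier_H mult_H one_H F.arr_comp[of _ _ "x p\<^sub>0"] F.arr_id x_proj p0_proj
  F.assoc F.arr_carrier F.arr_left)

sublocale H: group H
  by (rule group_H)

lemma inv_H:
  assumes "X \<in> carrier H" shows "inv\<^bsub>H\<^esub> X = star (PG_star P) X"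
  using assms F.arr_star F.arr_cancel(2)
  by (intro H.inv_equality) (auto simp: carrier_H mult_H one_H)

text \<open>The spanning tree provides paths \<open>rho p\<close> from the root, the \<open>\<L>\<close>-class of \<open>p\<^sub>0\<close>, to the
  \<open>\<R>\<close>-class of \<open>p\<close> and \<open>lam q\<close> to the \<open>\<L>\<close>-class of \<open>q\<close>.\<close>

definition vproj :: "'a set + 'a set \<Rightarrow> 'a" where
  "vproj v = (THE p. p \<in> projections S \<and> p \<in> (case v of Inl C \<Rightarrow> C | Inr C \<Rightarrow> C))"

lemma vproj_Inl: "e \<in> carrier S \<Longrightarrow> vproj (Inl (green_R S `` {e})) = e \<cdot> star S e"
  unfolding vproj_def
  using proj_lproj[of e] green_R_iff[of e]
  by (intro the_equality) (auto simp: proj_simps regular_star)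

lemma vproj_Inr: "e \<in> carrier S \<Longrightarrow> vproj (Inr (green_L S `` {e})) = star S e \<cdot> e"
  unfolding vproj_def
  using proj_rproj[of e] green_L_iff[of e]
  by (intro the_equality) (auto simp: proj_simps regular')

text \<open>An instance of \<open>tree_potential\<close>: values are arrows starting at
  \<open>x p\<^sub>0\<close>, and transport is right multiplication by the projection of the next
  vertex. It is reversible because adjacent vertices carry friendly projections.\<close>

lemma tree_paths:
  "\<exists>rho lam. lam p\<^sub>0 = x p\<^sub>0 \<and>
    (\<forall>p \<in> PD. F.arr (x p\<^sub>0) (rho p) (x p) \<and> F.arr (x p\<^sub>0) (lam p) (x p)) \<and>
    (\<forall>e \<in> T. lam (star S e \<cdot> e) = rho (e \<cdot> star S e) \<odot> x (star S e \<cdot> e) \<and>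
      rho (e \<cdot> star S e) = lam (star S e \<cdot> e) \<odot> x (e \<cdot> star S e))"
proof -
  define V where "V = fst (GH_graph S D)"
  define E where "E = GH_edge S ` T"
  have V: "V = D // green_R S <+> D // green_L S" unfolding V_def GH_graph_def by simp
  have tree': "tree_graph (V, E)"
    using tree unfolding GH_spanning_tree_def spanning_tree_edges_def V_def E_def by simp
  have DC: "d \<in> carrier S" if "d \<in> D" for d using that D_iff by blast
  have root: "Inr (green_L S `` {p\<^sub>0}) \<in> V"
    unfolding V using PD_ED[OF p0_PD] by (auto simp: ED_def intro: quotientI)
  have edge: "u \<in> V \<and> u \<noteq> v \<and> friendly (vproj u) (vproj v) \<and> vproj u \<in> PD \<and> vproj v \<in> PD"
    if uv: "{u, v} \<in> E" for u v
  proof -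
    obtain e where e: "e \<in> T" "{u, v} = {Inl (green_R S `` {e}), Inr (green_L S `` {e})}"
      using uv unfolding E_def GH_edge_def by auto
    have "e \<in> ED" using e(1) T_ED by blast
    note f = ED_friendly[OF this] friendly_sym[OF ED_friendly(1)[OF this]]
    have "e \<in> D" using \<open>e \<in> ED\<close> unfolding ED_def by simp
    have V': "Inl (green_R S `` {e}) \<in> V" "Inr (green_L S `` {e}) \<in> V"
      unfolding V using \<open>e \<in> D\<close> by (auto intro: quotientI)
    from e(2) consider "u = Inl (green_R S `` {e})" "v = Inr (green_L S `` {e})"
      | "v = Inl (green_R S `` {e})" "u = Inr (green_L S `` {e})"
      by (auto simp: doubleton_eq_iff)
    then show ?thesis
      using f V' by cases (simp_all add: vproj_Inl vproj_Inr DC[OF \<open>e \<in> D\<close>])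
  qed
  have "\<exists>f. f (Inr (green_L S `` {p\<^sub>0})) = x p\<^sub>0 \<and> (\<forall>v \<in> V. F.arr (x p\<^sub>0) (f v) (x (vproj v))) \<and>
      (\<forall>u v. {u, v} \<in> E \<longrightarrow> f v = f u \<odot> x (vproj v))"
  proof (rule tree_potential[OF tree' root])
    show "F.arr (x p\<^sub>0) (x p\<^sub>0) (x (vproj (Inr (green_L S `` {p\<^sub>0}))))"
      using p0_proj by (simp add: vproj_Inr proj_simps F.arr_id x_proj)
    show "u \<in> V \<and> u \<noteq> v" if "{u, v} \<in> E" for u v
      using edge[OF that] by simp
    fix u v w
    assume uv: "{u, v} \<in> E" and w: "F.arr (x p\<^sub>0) w (x (vproj u))"
    note fr = x_arr[OF edge[OF uv, THEN conjunct2, THEN conjunct2, THEN conjunct1]]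
    have P: "x (vproj u) \<in> carrier (PG_star P)" "x (vproj v) \<in> carrier (PG_star P)"
      using edge[OF uv] PD_proj x_closed by auto
    have wc: "w \<in> carrier (PG_star P)" using F.arr_carrier[OF w] .
    have 1: "w \<odot> x (vproj v) = w \<odot> (x (vproj u) \<odot> x (vproj v))"
      using F.arr_right'[OF w P(2)] by simp
    have "F.arr (x p\<^sub>0) (w \<odot> x (vproj v)) (x (vproj v))"
      unfolding 1 by (rule F.arr_comp[OF w F.friendly_arr[OF fr]])
    moreover have "w \<odot> x (vproj v) \<odot> x (vproj u) = w \<odot> (x (vproj u) \<odot> x (vproj v) \<odot> x (vproj u))"
      unfolding 1 using P wc by (simp add: F.assoc F.closed)
    then have "w \<odot> x (vproj v) \<odot> x (vproj u) = w"
      using fr F.arr_right[OF w] unfolding F.friendly_def by simp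
    ultimately show "F.arr (x p\<^sub>0) (w \<odot> x (vproj v)) (x (vproj v)) \<and> w \<odot> x (vproj v) \<odot> x (vproj u) = w"
      by simp
  qed
  then obtain f where *: "f (Inr (green_L S `` {p\<^sub>0})) = x p\<^sub>0 \<and>
      (\<forall>v \<in> V. F.arr (x p\<^sub>0) (f v) (x (vproj v))) \<and>
      (\<forall>u v. {u, v} \<in> E \<longrightarrow> f v = f u \<odot> x (vproj v))" by (rule exE)
  have f: "f (Inr (green_L S `` {p\<^sub>0})) = x p\<^sub>0"
    "\<And>v. v \<in> V \<Longrightarrow> F.arr (x p\<^sub>0) (f v) (x (vproj v))"
    "\<And>u v. {u, v} \<in> E \<Longrightarrow> f v = f u \<odot> x (vproj v)"
    using * by simp_all
  define rho where "rho p = f (Inl (green_R S `` {p}))" for p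
  define lam where "lam p = f (Inr (green_L S `` {p}))" for p
  have arrows: "F.arr (x p\<^sub>0) (rho p) (x p) \<and> F.arr (x p\<^sub>0) (lam p) (x p)" if p: "p \<in> PD" for p
  proof -
    have "p \<in> D" using PD_ED[OF p] unfolding ED_def by simp
    then have "Inl (green_R S `` {p}) \<in> V" "Inr (green_L S `` {p}) \<in> V"
      unfolding V by (auto intro: quotientI)
    from this[THEN f(2)] show ?thesis
      unfolding rho_def lam_def using PD_proj[OF p] by (simp add: vproj_Inl vproj_Inr proj_simps)
  qed
  have edges: "lam (star S e \<cdot> e) = rho (e \<cdot> star S e) \<odot> x (star S e \<cdot> e) \<and>
      rho (e \<cdot> star S e) = lam (star S e \<cdot> e) \<odot> x (e \<cdot> star S e)" if e: "e \<in> T" for e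
  proof -
    have "e \<in> D" using e T_ED unfolding ED_def by blast
    then have ec: "e \<in> carrier S" by (rule DC)
    have c: "e \<cdot> star S e \<in> carrier S" "star S e \<cdot> e \<in> carrier S" using ec closed star_closed by auto
    have "(e, e \<cdot> star S e) \<in> green_R S" "(e, star S e \<cdot> e) \<in> green_L S"
      using ec c by (simp_all add: green_R_iff green_L_iff proj_simps regular_star regular')
    then have cl: "green_R S `` {e \<cdot> star S e} = green_R S `` {e}" "green_L S `` {star S e \<cdot> e} = green_L S `` {e}"
      unfolding green_R_def green_L_def by auto
    have "{Inl (green_R S `` {e}), Inr (green_L S `` {e})} \<in> E"
      using e unfolding E_def GH_edge_def by blast
    then have "{Inl (green_R S `` {e}), Inr (green_L S `` {e})} \<in> E"
      "{Inr (green_L S `` {e}), Inl (green_R S `` {e})} \<in> E" by (simp_all add: insert_commute)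
    from this[THEN f(3)] show ?thesis
      unfolding rho_def lam_def cl vproj_Inl[OF ec] vproj_Inr[OF ec] by (rule conjI)
  qed
  have "lam p\<^sub>0 = x p\<^sub>0" unfolding lam_def by (rule f(1))
  then show ?thesis by (intro exI[of _ rho] exI[of _ lam] conjI[OF _ conjI] ballI arrows edges)
qed

text \<open>Induction along tree edges in both directions from the root, with \<open>QR\<close> at
  \<R>-class vertices and \<open>QL\<close> at \<L>-class vertices. It serves to compute the weights
  of the tree paths.\<close>

lemma tree_induct:
  assumes base: "QL p\<^sub>0"
    and step: "\<And>e. e \<in> T \<Longrightarrow> QR (e \<cdot> star S e) \<longleftrightarrow> QL (star S e \<cdot> e)"
    and p: "p \<in> PD"
  shows "QR p \<and> QL p"
proof -
  define V where "V = fst (GH_graph S D)"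
  define E where "E = GH_edge S ` T"
  have V: "V = D // green_R S <+> D // green_L S" unfolding V_def GH_graph_def by simp
  have conn: "connected_graph (V, E)"
    using tree unfolding GH_spanning_tree_def spanning_tree_edges_def tree_graph_def V_def E_def by simp
  define Q where "Q v = (case v of Inl _ \<Rightarrow> QR (vproj v) | Inr _ \<Rightarrow> QL (vproj v))" for v
  have edge: "Q u \<longleftrightarrow> Q v" if uv: "{u, v} \<in> E" for u v
  proof -
    obtain e where e: "e \<in> T" "{u, v} = {Inl (green_R S `` {e}), Inr (green_L S `` {e})}"
      using uv unfolding E_def GH_edge_def by auto
    have "e \<in> carrier S" using e(1) T_ED D_iff unfolding ED_def by blast
    then have "Q (Inl (green_R S `` {e})) \<longleftrightarrow> Q (Inr (green_L S `` {e}))"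
      unfolding Q_def using step[OF e(1)] by (simp add: vproj_Inl vproj_Inr)
    then show ?thesis using e(2) by (auto simp: doubleton_eq_iff)
  qed
  have Qp: "Q (Inl (green_R S `` {p})) \<longleftrightarrow> QR p" "Q (Inr (green_L S `` {p})) \<longleftrightarrow> QL p"
    if "p \<in> PD" for p
    unfolding Q_def using PD_proj[OF that] by (simp_all add: vproj_Inl vproj_Inr proj_simps)
  have in_V: "Inl (green_R S `` {p}) \<in> V" "Inr (green_L S `` {p}) \<in> V" if "p \<in> PD" for p
    unfolding V using PD_ED[OF that] by (auto simp: ED_def intro: quotientI)
  have "Q v" if "v \<in> V" for v
  proof -
    have "(Inr (green_L S `` {p\<^sub>0}), v) \<in> {(x, y). {x, y} \<in> E}\<^sup>*"
      using conn in_V(2)[OF p0_PD] that unfolding connected_graph_def by simp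
    then show ?thesis
      by (induction rule: rtrancl_induct) (use Qp(2)[OF p0_PD] base edge in auto)
  qed
  then show ?thesis using Qp[OF p] in_V[OF p] by blast
qed

end

section \<open>The two homomorphisms for a fixed choice of tree paths\<close>

locale pg_subgroup_paths = pg_subgroup S P p\<^sub>0 D T
  for S :: "'a star_semigrp" (structure) and P p\<^sub>0 D T +
  fixes rho lam :: "'a \<Rightarrow> 'a list set"
  assumes lam_p0: "lam p\<^sub>0 = x p\<^sub>0"
    and rho_arr: "p \<in> PD \<Longrightarrow> F.arr (x p\<^sub>0) (rho p) (x p)"
    and lam_arr: "p \<in> PD \<Longrightarrow> F.arr (x p\<^sub>0) (lam p) (x p)"
    and lam_tree: "e \<in> T \<Longrightarrow> lam (star S e \<cdot> e) = rho (e \<cdot> star S e) \<odot> x (star S e \<cdot> e)"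
    and rho_tree: "e \<in> T \<Longrightarrow> rho (e \<cdot> star S e) = lam (star S e \<cdot> e) \<odot> x (e \<cdot> star S e)"
begin

definition loop :: "'a \<Rightarrow> 'a list set" where
  "loop e = rho (e \<cdot> star S e) \<odot> xi e \<odot> star (PG_star P) (lam (star S e \<cdot> e))"

lemma loop_arr: "e \<in> ED \<Longrightarrow> F.arr (x p\<^sub>0) (loop e) (x p\<^sub>0)"
  unfolding loop_def
  using ED_friendly[of e] F.arr_comp[OF F.arr_comp[OF rho_arr xi_arr] F.arr_star[OF lam_arr]]
  by (simp add: ED_def)

lemma loop_H: "e \<in> ED \<Longrightarrow> loop e \<in> carrier H"
  using loop_arr unfolding carrier_H .

text \<open>The paths \<open>rho\<close> to the common \<R>-class cancel. Both sides of every
  relation other than those for \<open>T\<close> have the form treated here.\<close>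

lemma loop_quotient:
  assumes "e \<in> ED" "f \<in> ED" "e \<cdot> star S e = f \<cdot> star S f"
  shows "inv\<^bsub>H\<^esub> loop e \<otimes>\<^bsub>H\<^esub> loop f =
    lam (star S e \<cdot> e) \<odot> (star (PG_star P) (xi e) \<odot> xi f) \<odot> star (PG_star P) (lam (star S f \<cdot> f))"
proof -
  note d = ED_friendly[OF assms(1)] ED_friendly[OF assms(2)]
  have i: "e \<in> idempotents S" "f \<in> idempotents S" using assms unfolding ED_def by auto
  note a = rho_arr[OF d(2)] lam_arr[OF d(3)] lam_arr[OF d(7)] xi_arr[OF i(1)] xi_arr[OF i(2)]
  note c = a[THEN F.arr_carrier]
  note [simp] = c F.closed F.star_closed F.star_mult F.star_star F.assoc
  have "star (PG_star P) (loop e) \<odot> loop f = lam (star S e \<cdot> e) \<odot> (star (PG_star P) (xi e) \<odot>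
      ((star (PG_star P) (rho (e \<cdot> star S e)) \<odot> rho (e \<cdot> star S e)) \<odot>
       (xi f \<odot> star (PG_star P) (lam (star S f \<cdot> f)))))"
    unfolding loop_def assms(3)[symmetric] by simp
  also have "(star (PG_star P) (rho (e \<cdot> star S e)) \<odot> rho (e \<cdot> star S e)) \<odot>
       (xi f \<odot> star (PG_star P) (lam (star S f \<cdot> f))) = xi f \<odot> star (PG_star P) (lam (star S f \<cdot> f))"
    unfolding F.arr_cancel(2)[OF a(1)] unfolding assms(3) by (rule F.arr_left'[OF a(5)]) simp
  finally show ?thesis using loop_H[OF assms(1)] by (simp add: inv_H mult_H)
qed

text \<open>For a tree edge, \<open>rho\<close> followed by \<open>xi e\<close> is the path
  \<open>lam\<close>, which is then traversed backwards.\<close>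

lemma loop_tree:
  assumes "e \<in> T" shows "loop e = x p\<^sub>0"
proof -
  have e: "e \<in> ED" "e \<in> idempotents S" using assms T_ED unfolding ED_def by auto
  note d = ED_friendly[OF e(1)]
  note a = rho_arr[OF d(2)] lam_arr[OF d(3)] xi_arr[OF e(2)]
  have "rho (e \<cdot> star S e) \<odot> xi e = lam (star S e \<cdot> e)"
    unfolding xi_def lam_tree[OF assms]
    by (rule F.arr_right'[OF a(1)]) (simp add: x_closed PD_proj d)
  then show ?thesis unfolding loop_def using F.arr_cancel(1)[OF a(2)] by simp
qed

lemma xi_proj: "p \<in> projections S \<Longrightarrow> xi p = x p"
  unfolding xi_def by (simp add: proj_simps x_idem)

lemma singular_square_ED:
  assumes "singular_square S e f g h" "{e, f, g, h} \<subseteq> D"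
  shows "e \<in> ED" "f \<in> ED" "g \<in> ED" "h \<in> ED"
  using assms unfolding singular_square_def idempotent_square_def ED_def by auto

lemma presented_hom: "\<exists>\<psi> \<in> hom GP H. \<forall>e \<in> ED. \<psi> (ag e) = loop e"
proof (rule pres.universal_property[OF group_H])
  show "loop \<in> ED \<rightarrow> carrier H" using loop_H by blast
  have eval: "pres.gword_eval H loop (gen_inv a @ gen b) = inv\<^bsub>H\<^esub> loop a \<otimes>\<^bsub>H\<^esub> loop b"
    if "a \<in> ED" "b \<in> ED" for a b
    using that loop_H unfolding pres.gword_eval_def by simp
  fix u v assume "(u, v) \<in> rels"
  then consider (tree) e where "e \<in> T" "u = gen e" "v = []"
    | (star) e where "e \<in> ED" "u = gen_inv (e \<cdot> star S e) @ gen e" "v = gen_inv (star S e) @ gen (star S e \<cdot> e)"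
    | (square) e f g h where "singular_square S e f g h" "{e, f, g, h} \<subseteq> D"
        "u = gen_inv e @ gen f" "v = gen_inv g @ gen h"
    unfolding rels_def by (elim UnE CollectE exE conjE Pair_inject) (rule that; assumption)+
  then show "pres.gword_eval H loop u = pres.gword_eval H loop v"
  proof cases
    case tree
    then show ?thesis
      using HOL.trans[OF loop_tree[OF tree(1)] one_H[symmetric]] unfolding pres.gword_eval_def by simp
  next
    case star
    obtain p q where pq: "friendly p q" "p \<in> PD" "q \<in> PD" "e = p \<cdot> q" "e \<cdot> star S e = p" "star S e \<cdot> e = q"
      by (rule ED_cases[OF star(1)])
    have P: "p \<in> projections S" "q \<in> projections S" using pq PD_proj by auto
    note qp = friendly_sym[OF pq(1)]
    have e': "star S e = q \<cdot> p" unfolding pq(4) by (rule friendly_star[OF pq(1)])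
    have ED: "p \<in> ED" "q \<in> ED" "star S e \<in> ED" "e \<in> ED"
      using star(1) PD_ED[OF pq(2)] PD_ED[OF pq(3)] friendly_ED[OF qp pq(3)] e' by simp_all
    have i: "e \<in> idempotents S" using ED unfolding ED_def by simp
    have ends: "star S e \<cdot> star S (star S e) = q" "star S (star S e) \<cdot> star S e = p"
      "p \<cdot> star S p = p" "star S p \<cdot> p = p" "q \<cdot> star S q = q" "star S q \<cdot> q = q"
      using pq(5,6) P idempotent_products(1)[OF i] by (simp_all add: star_star proj_star proj_idem)
    have c: "xi e \<in> carrier (PG_star P)" using xi_arr[OF i] F.arr_carrier by blast
    \<comment> \<open>Both quotients reduce to \<open>xi e\<close>, between the same two paths
      \<open>lam\<close>.\<close>
    have "star (PG_star P) (xi p) \<odot> xi e = xi e"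
      using F.arr_left[OF xi_arr[OF i]] unfolding pq(5) by (simp add: xi_proj P x_star)
    moreover have "star (PG_star P) (xi (star S e)) \<odot> xi q = xi e"
      using F.arr_right[OF xi_arr[OF i]] c unfolding pq(6) by (simp add: xi_star i xi_proj P F.star_star)
    ultimately have "inv\<^bsub>H\<^esub> loop p \<otimes>\<^bsub>H\<^esub> loop e = inv\<^bsub>H\<^esub> loop (star S e) \<otimes>\<^bsub>H\<^esub> loop q"
      using loop_quotient[OF ED(1,4)] loop_quotient[OF ED(3,2)] by (simp only: ends pq(5,6))
    then show ?thesis unfolding star(2,3) pq(5,6) eval[OF ED(1,4)] eval[OF ED(3,2)] .
  next
    case square
    note ED = singular_square_ED[OF square(1,2)]
    note s = idempotent_square_ends[OF square(1)[unfolded singular_square_def, THEN conjunct1]]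
    show ?thesis
      unfolding square(3,4) eval[OF ED(1,2)] eval[OF ED(3,4)]
        loop_quotient[OF ED(1,2) s(5)] loop_quotient[OF ED(3,4) s(6)]
      by (simp only: s(7,8) singular_square_xi[OF square(1)])
  qed
qed

text \<open>For loops at \<open>p\<^sub>0\<close> this says that \<open>\<psi>\<close> recovers an
  element from its weight. The starting vertex is left free because every letter of the word changes
  it.\<close>

lemma psi_weight:
  assumes psi: "\<psi> \<in> hom GP H" "\<And>e. e \<in> ED \<Longrightarrow> \<psi> (ag e) = loop e"
    and X: "X \<in> carrier (PG_star P)" and p: "p \<in> PD" "F.arr (x p) (x p \<odot> X) Y"
  shows "\<exists>q h. q \<in> PD \<and> h \<in> carrier GP \<and> Y = x q \<and> Act (Some (p, \<one>\<^bsub>GP\<^esub>)) X = Some (q, h) \<and>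
    \<psi> h = lam p \<odot> X \<odot> star (PG_star P) (lam q)"
  using X p
proof (induction arbitrary: p rule: PG_star_induct)
  interpret psi: group_hom GP H \<psi>
    using psi(1) by unfold_locales
  have letter: "F.arr (x p) (x p \<odot> x r) (x (r \<cdot> p \<cdot> r)) \<and>
      \<psi> (bw p (r \<cdot> p \<cdot> r)) = lam p \<odot> x r \<odot> star (PG_star P) (lam (r \<cdot> p \<cdot> r))"
    if r: "r \<in> projections S" and p: "p \<in> PD" "p \<cdot> r \<cdot> p = p" for p r
  proof -
    define q where "q = r \<cdot> p \<cdot> r"
    note q = PD_sandwich[OF p(1) r p(2), folded q_def]
    note P = PD_proj[OF p(1)] PD_proj[OF q(2)]
    have "x p \<odot> x r \<odot> x p = x p" using x_sandwich[OF P(1) r] p(2) by simp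
    note F.arr_mult_proj[OF F.arr_id[OF x_proj[OF P(1)]] x_proj[OF r] this]
      F.friendly_sandwich(2)[OF x_proj[OF P(1)] x_proj[OF r] this]
    then have arr: "F.arr (x p) (x p \<odot> x r) (x q)" and pq: "x p \<odot> x q = x p \<odot> x r"
      using x_sandwich[OF r P(1)] unfolding q_def by simp_all
    note ED = PD_ED[OF p(1)] friendly_ED[OF q(1) p(1)]
    have i: "p \<cdot> q \<in> idempotents S" using ED unfolding ED_def by simp
    note pqa = friendly_arr[OF q(1)]
    \<comment> \<open>The weight of a letter is a quotient of two generators, and the corresponding
      quotient of loops is given by \<open>loop_quotient\<close>.\<close>
    have "\<psi> (bw p q) = inv\<^bsub>H\<^esub> loop p \<otimes>\<^bsub>H\<^esub> loop (p \<cdot> q)"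
      unfolding bw_def using ED psi(2) by simp
    also have "\<dots> = lam p \<odot> (star (PG_star P) (x p) \<odot> xi (p \<cdot> q)) \<odot> star (PG_star P) (lam q)"
      using loop_quotient[OF ED] arr_cancel[OF pqa] P by (simp add: proj_star proj_idem xi_proj)
    also have "star (PG_star P) (x p) \<odot> xi (p \<cdot> q) = x p \<odot> x r"
      using F.arr_left[OF xi_arr[OF i]] arr_cancel[OF pqa] P pq by (simp add: x_star) (simp add: xi_def)
    also have "lam p \<odot> (x p \<odot> x r) = lam p \<odot> x r"
      by (rule F.arr_right'[OF lam_arr[OF p(1)] x_closed[OF r]])
    finally show ?thesis using arr unfolding q_def by simp
  qed
  \<comment> \<open>The condition in \<open>PG(P)\<close> is brought back to \<open>S\<close> by
    injectivity of \<open>x\<close>.\<close>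
  have defined: "p \<cdot> r \<cdot> p = p"
    if r: "r \<in> projections S" and p: "p \<in> PD" and "x p \<odot> x r \<odot> star (PG_star P) (x p \<odot> x r) = x p" for p r
  proof -
    note P = PD_proj[OF p]
    have "x p \<odot> x r \<odot> star (PG_star P) (x p \<odot> x r) = x p \<odot> (x r \<odot> x r) \<odot> x p"
      using r P by (simp add: F.star_mult F.assoc F.closed x_closed x_star)
    then have "x (p \<cdot> r \<cdot> p) = x p" using that(3) x_idem[OF r] x_sandwich[OF P r] by simp
    then show ?thesis using x_inj proj_sandwich P r by blast
  qed
  {
    case (gen r)
    have prp: "p \<cdot> r \<cdot> p = p" using defined[OF gen(1,2)] F.arr_cancel(1)[OF gen(3)] by blast
    note q = PD_sandwich[OF gen(2,1) prp]
    note l = letter[OF gen(1,2) prp]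
    show ?case
      using l q prp gen bw_closed[OF q(1) gen(2)] F.arr_cancel(2)[OF conjunct1[OF l]] F.arr_cancel(2)[OF gen(3)]
      by (intro exI[of _ "r \<cdot> p \<cdot> r"] exI[of _ "bw p (r \<cdot> p \<cdot> r)"]) (simp add: Act_x act_Some)
  next
    case (mult r z)
    note r = mult.hyps(1) and z = mult.hyps(2) and p = mult.prems(1)
    note xc = x_closed[OF r] x_closed[OF PD_proj[OF p]]
    have arr: "F.arr (x p) ((x p \<odot> x r) \<odot> z) Y" using mult.prems(2) xc z by (simp add: F.assoc)
    have "(x p \<odot> x r) \<odot> star (PG_star P) (x p \<odot> x r) = x p"
      by (rule F.arr_prefix[OF arr _ z])
        (use xc in \<open>simp_all add: F.closed F.assoc[symmetric] x_idem PD_proj[OF p]\<close>)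
    then have prp: "p \<cdot> r \<cdot> p = p" by (rule defined[OF r p])
    define q where "q = r \<cdot> p \<cdot> r"
    note q = PD_sandwich[OF p r prp, folded q_def]
    note l = letter[OF r p prp, folded q_def]
    note bc = bw_closed[OF q(1) p]
    have c: "lam p \<in> carrier (PG_star P)" "lam q \<in> carrier (PG_star P)"
      using lam_arr p q(2) F.arr_carrier by blast+
    note xq = x_closed[OF PD_proj[OF q(2)]]
    have "star (PG_star P) (x p \<odot> x r) \<odot> ((x p \<odot> x r) \<odot> z) = x q \<odot> z"
      using F.arr_cancel(2)[OF conjunct1[OF l]] xc z by (simp add: F.assoc[symmetric] F.closed F.star_closed)
    then have "F.arr (x q) (x q \<odot> z) Y"
      using F.arr_comp[OF F.arr_star[OF conjunct1[OF l]] arr] by simp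
    from mult.IH[OF q(2) this] obtain t h where h: "t \<in> PD" "h \<in> carrier GP" "Y = x t"
      "Act (Some (q, \<one>\<^bsub>GP\<^esub>)) z = Some (t, h)" "\<psi> h = lam q \<odot> z \<odot> star (PG_star P) (lam t)" by blast
    have tc: "lam t \<in> carrier (PG_star P)" using lam_arr[OF h(1)] F.arr_carrier by blast
    have "Act (Some (p, \<one>\<^bsub>GP\<^esub>)) (x r \<odot> z) = Act (Some (q, bw p q)) z"
      using p r prp xc z bc by (simp add: Act_mult Act_x act_Some q_def[symmetric])
    also have "\<dots> = Some (t, bw p q \<otimes>\<^bsub>GP\<^esub> h)" by (rule Act_weight[OF q(2) bc z h(4)])
    finally have A: "Act (Some (p, \<one>\<^bsub>GP\<^esub>)) (x r \<odot> z) = Some (t, bw p q \<otimes>\<^bsub>GP\<^esub> h)" .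
    have "\<psi> (bw p q \<otimes>\<^bsub>GP\<^esub> h) = \<psi> (bw p q) \<odot> \<psi> h" using bc h(2) by (simp add: mult_H)
    \<comment> \<open>The path \<open>lam q\<close> taken backwards and forwards leaves
      \<open>x q\<close>, which is absorbed by \<open>x p \<odot> x r\<close>, an arrow ending
      there.\<close>
    also have "\<dots> = lam p \<odot> x r \<odot> ((star (PG_star P) (lam q) \<odot> lam q) \<odot> (z \<odot> star (PG_star P) (lam t)))"
      using l h(5) c tc z xc by (simp add: F.assoc F.closed F.star_closed)
    also have "\<dots> = lam p \<odot> (x p \<odot> (x r \<odot> (x q \<odot> (z \<odot> star (PG_star P) (lam t)))))"
      unfolding F.arr_cancel(2)[OF lam_arr[OF q(2)]]
      using F.arr_right'[OF lam_arr[OF p]] c tc z xc xq by (simp add: F.assoc F.closed F.star_closed)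
    also have "\<dots> = lam p \<odot> ((x p \<odot> x r) \<odot> (x q \<odot> (z \<odot> star (PG_star P) (lam t))))"
      using c tc z xc xq by (simp add: F.assoc F.closed F.star_closed)
    also have "(x p \<odot> x r) \<odot> (x q \<odot> (z \<odot> star (PG_star P) (lam t))) = (x p \<odot> x r) \<odot> (z \<odot> star (PG_star P) (lam t))"
      by (rule F.arr_right'[OF conjunct1[OF l]]) (use z tc in \<open>simp add: F.closed F.star_closed\<close>)
    also have "lam p \<odot> ((x p \<odot> x r) \<odot> (z \<odot> star (PG_star P) (lam t))) = lam p \<odot> (x r \<odot> z) \<odot> star (PG_star P) (lam t)"
      using F.arr_right'[OF lam_arr[OF p]] c tc z xc by (simp add: F.assoc F.closed F.star_closed)
    finally show ?case using A h bc by blast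
  }
qed

text \<open>On a tree edge \<open>e = p \<cdot> q\<close> the generator \<open>ag e\<close> is
  trivial, so \<open>bw p q\<close> is the inverse of \<open>ag p\<close> and \<open>bw q p\<close>
  is \<open>ag p\<close>. Each of the two formulas therefore propagates to the other across the
  edge.\<close>

lemma rho_lam_weight:
  "p \<in> PD \<Longrightarrow> Act (Some (p\<^sub>0, \<one>\<^bsub>GP\<^esub>)) (rho p) = Some (p, ag p) \<and>
    Act (Some (p\<^sub>0, \<one>\<^bsub>GP\<^esub>)) (lam p) = Some (p, \<one>\<^bsub>GP\<^esub>)"
proof (rule tree_induct)
  show "Act (Some (p\<^sub>0, \<one>\<^bsub>GP\<^esub>)) (lam p\<^sub>0) = Some (p\<^sub>0, \<one>\<^bsub>GP\<^esub>)"
    unfolding lam_p0 using Act_friendly[OF friendly_refl[OF p0_proj] p0_PD] bw_id[OF p0_PD] by simp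
  fix e assume e: "e \<in> T"
  then have "e \<in> ED" using T_ED by blast
  then obtain p q where pq: "friendly p q" "p \<in> PD" "q \<in> PD" "e = p \<cdot> q" "e \<cdot> star S e = p" "star S e \<cdot> e = q"
    by (rule ED_cases)
  note c = rho_arr[OF pq(2), THEN F.arr_carrier] lam_arr[OF pq(3), THEN F.arr_carrier]
    x_closed[OF PD_proj[OF pq(2)]] x_closed[OF PD_proj[OF pq(3)]]
  have ag_p: "ag p \<in> carrier GP" using PD_ED[OF pq(2)] by simp
  have b: "bw p q = inv\<^bsub>GP\<^esub> ag p"
    unfolding bw_def using ag_T[OF e] ag_p pq(4) by simp
  have b': "bw q p = ag p" unfolding bw_inv[OF pq(1,2)] b using ag_p by simp
  show "Act (Some (p\<^sub>0, \<one>\<^bsub>GP\<^esub>)) (rho (e \<cdot> star S e)) = Some (e \<cdot> star S e, ag (e \<cdot> star S e)) \<longleftrightarrow>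
    Act (Some (p\<^sub>0, \<one>\<^bsub>GP\<^esub>)) (lam (star S e \<cdot> e)) = Some (star S e \<cdot> e, \<one>\<^bsub>GP\<^esub>)"
    unfolding pq(5,6)
  proof
    assume "Act (Some (p\<^sub>0, \<one>\<^bsub>GP\<^esub>)) (rho p) = Some (p, ag p)"
    then show "Act (Some (p\<^sub>0, \<one>\<^bsub>GP\<^esub>)) (lam q) = Some (q, \<one>\<^bsub>GP\<^esub>)"
      using lam_tree[OF e] Act_friendly[OF pq(1,2) ag_p] c p0_PD ag_p b unfolding pq(5,6) by (simp add: Act_mult)
  next
    assume "Act (Some (p\<^sub>0, \<one>\<^bsub>GP\<^esub>)) (lam q) = Some (q, \<one>\<^bsub>GP\<^esub>)"
    then show "Act (Some (p\<^sub>0, \<one>\<^bsub>GP\<^esub>)) (rho p) = Some (p, ag p)"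
      using rho_tree[OF e] Act_friendly[OF friendly_sym[OF pq(1)] pq(3) G.one_closed] c p0_PD ag_p b'
      unfolding pq(5,6) by (simp add: Act_mult)
  qed
qed

text \<open>The path \<open>rho\<close> contributes \<open>ag p\<close>, the idempotent turns this
  into \<open>ag e\<close>, and the way back along \<open>lam\<close> contributes nothing.\<close>

lemma loop_weight:
  assumes "e \<in> ED"
  shows "Act (Some (p\<^sub>0, \<one>\<^bsub>GP\<^esub>)) (loop e) = Some (p\<^sub>0, ag e)"
proof -
  obtain p q where pq: "friendly p q" "p \<in> PD" "q \<in> PD" "e = p \<cdot> q" "e \<cdot> star S e = p" "star S e \<cdot> e = q"
    by (rule ED_cases[OF assms])
  note c = rho_arr[OF pq(2), THEN F.arr_carrier] lam_arr[OF pq(3), THEN F.arr_carrier]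
    x_closed[OF PD_proj[OF pq(2)]] x_closed[OF PD_proj[OF pq(3)]] x_closed[OF p0_proj]
  have ag: "ag p \<in> carrier GP" "ag e \<in> carrier GP" using PD_ED[OF pq(2)] assms by simp_all
  \<comment> \<open>The weight of the reversed path is found by first traversing
    \<open>lam q\<close>, since the full round trip is \<open>x p\<^sub>0\<close>.\<close>
  have "Act (Some (q, \<one>\<^bsub>GP\<^esub>)) (star (PG_star P) (lam q))
      = Act (Act (Some (p\<^sub>0, \<one>\<^bsub>GP\<^esub>)) (lam q)) (star (PG_star P) (lam q))"
    using rho_lam_weight[OF pq(3)] by simp
  also have "\<dots> = Act (Some (p\<^sub>0, \<one>\<^bsub>GP\<^esub>)) (x p\<^sub>0)"
    using Act_mult[of "Some (p\<^sub>0, \<one>\<^bsub>GP\<^esub>)" "lam q" "star (PG_star P) (lam q)"] c p0_PD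
      F.arr_cancel(1)[OF lam_arr[OF pq(3)]] by (simp add: F.star_closed)
  also have "\<dots> = Some (p\<^sub>0, \<one>\<^bsub>GP\<^esub>)"
    using rho_lam_weight[OF p0_PD] unfolding lam_p0 by simp
  finally have "Act (Some (q, ag e)) (star (PG_star P) (lam q)) = Some (p\<^sub>0, ag e)"
    using Act_weight[OF pq(3) ag(2) F.star_closed[OF c(2)]] ag by simp
  moreover have "Act (Some (p, ag p)) (x p) = Some (p, ag p)"
    using Act_friendly[OF friendly_refl[OF PD_proj[OF pq(2)]] pq(2) ag(1)] bw_id[OF pq(2)] ag by simp
  moreover have "Act (Some (p, ag p)) (x q) = Some (q, ag e)"
    using Act_friendly[OF pq(1,2) ag(1)] ag unfolding bw_def pq(4)[symmetric] by (simp add: G.m_assoc[symmetric])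
  ultimately show ?thesis
    unfolding loop_def xi_def pq(5,6)
    using c p0_PD pq(2,3) ag rho_lam_weight[OF pq(2)] by (simp add: Act_mult F.closed F.star_closed)
qed

text \<open>\<open>\<gamma>\<close> is injective because \<open>\<psi>\<close> is a left inverse of
  it, and surjective because the loops are sent to the generators.\<close>

lemma maximal_subgroup_iso: "H \<cong> GP"
proof -
  obtain \<psi> where psi: "\<psi> \<in> hom GP H" "\<And>e. e \<in> ED \<Longrightarrow> \<psi> (ag e) = loop e"
    using presented_hom by blast
  \<comment> \<open>On \<open>H\<close> the option is never \<open>None\<close>:
    \<open>psi_weight\<close> shows that the action is defined there and returns to
    \<open>p\<^sub>0\<close>.\<close>
  define \<gamma> where "\<gamma> X = snd (the (Act (Some (p\<^sub>0, \<one>\<^bsub>GP\<^esub>)) X))" for X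
  have gamma: "\<gamma> X \<in> carrier GP" "Act (Some (p\<^sub>0, \<one>\<^bsub>GP\<^esub>)) X = Some (p\<^sub>0, \<gamma> X)" "\<psi> (\<gamma> X) = X"
    if X: "X \<in> carrier H" for X
  proof -
    have a: "F.arr (x p\<^sub>0) X (x p\<^sub>0)" using X unfolding carrier_H .
    then have "F.arr (x p\<^sub>0) (x p\<^sub>0 \<odot> X) (x p\<^sub>0)" using F.arr_left by simp
    from psi_weight[OF psi F.arr_carrier[OF a] p0_PD this] obtain q h where h: "q \<in> PD" "h \<in> carrier GP"
      "x p\<^sub>0 = x q" "Act (Some (p\<^sub>0, \<one>\<^bsub>GP\<^esub>)) X = Some (q, h)"
      "\<psi> h = lam p\<^sub>0 \<odot> X \<odot> star (PG_star P) (lam q)" by blast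
    have q: "q = p\<^sub>0" using x_inj[OF p0_proj PD_proj[OF h(1)] h(3)] by simp
    have "\<psi> h = X"
      using h(5) unfolding q lam_p0 x_star[OF p0_proj] F.arr_left[OF a] F.arr_right[OF a] .
    then show "\<gamma> X \<in> carrier GP" "Act (Some (p\<^sub>0, \<one>\<^bsub>GP\<^esub>)) X = Some (p\<^sub>0, \<gamma> X)" "\<psi> (\<gamma> X) = X"
      unfolding \<gamma>_def using h q by simp_all
  qed
  have HF: "X \<in> carrier (PG_star P)" if "X \<in> carrier H" for X
    using that F.arr_carrier unfolding carrier_H by blast
  have hom: "\<gamma> \<in> hom H GP"
  proof (rule homI)
    fix X Y assume XY: "X \<in> carrier H" "Y \<in> carrier H"
    have "Some (p\<^sub>0, \<gamma> (X \<odot> Y)) = Act (Some (p\<^sub>0, \<gamma> X)) Y"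
      using gamma(2)[OF H.m_closed[OF XY]] gamma(2)[OF XY(1)] XY HF p0_PD by (simp add: mult_H Act_mult)
    also have "\<dots> = Some (p\<^sub>0, \<gamma> X \<otimes>\<^bsub>GP\<^esub> \<gamma> Y)"
      by (rule Act_weight[OF p0_PD gamma(1)[OF XY(1)] HF[OF XY(2)] gamma(2)[OF XY(2)]])
    finally show "\<gamma> (X \<otimes>\<^bsub>H\<^esub> Y) = \<gamma> X \<otimes>\<^bsub>GP\<^esub> \<gamma> Y" by (simp add: mult_H)
  qed (rule gamma(1))
  interpret gamma: group_hom H GP \<gamma>
    using hom by unfold_locales
  have loop: "\<gamma> (loop e) = ag e" if "e \<in> ED" for e
    using loop_weight[OF that] unfolding \<gamma>_def by simp
  have surj: "z \<in> \<gamma> ` carrier H" if "z \<in> carrier GP" for z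
    using that
  proof (induction rule: pres.grp_induct)
    case one
    then show ?case using gamma.hom_one H.one_closed by (metis imageI)
  next
    case (gen e z)
    then obtain Z where Z: "Z \<in> carrier H" "z = \<gamma> Z" by blast
    have "\<gamma> (loop e \<otimes>\<^bsub>H\<^esub> Z) = ag e \<otimes>\<^bsub>GP\<^esub> z" using Z loop_H gen loop by simp
    then show ?case using Z loop_H[OF gen(1)] by (metis H.m_closed imageI)
  next
    case (gen_inv e z)
    then obtain Z where Z: "Z \<in> carrier H" "z = \<gamma> Z" by blast
    have "\<gamma> (inv\<^bsub>H\<^esub> loop e \<otimes>\<^bsub>H\<^esub> Z) = inv\<^bsub>GP\<^esub> ag e \<otimes>\<^bsub>GP\<^esub> z" using Z loop_H gen_inv loop by simp
    then show ?case using Z loop_H[OF gen_inv(1)] by (metis H.m_closed H.inv_closed imageI)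
  qed
  have "inj_on \<gamma> (carrier H)" using gamma(3) by (rule inj_on_inverseI)
  moreover have "\<gamma> ` carrier H = carrier GP" using surj gamma(1) by blast
  ultimately show ?thesis using hom unfolding is_iso_def iso_def bij_betw_def by blast
qed

end

theorem theorem7p18:
  fixes S :: "'a star_semigrp" and P :: "'a proj_alg"
    and p\<^sub>0 :: 'a and D E\<^sub>D T :: "'a set"
  assumes "regular_star_semigroup S"
    and "projection_generated S"
    and "projection_algebra_of S P"
    and "p\<^sub>0 \<in> carrier P"
    and "D = green_D S `` {p\<^sub>0}"
    and "E\<^sub>D = idempotents S \<inter> D"
    and "GH_spanning_tree S D T"
  shows "maximal_subgroup (PG P) (PG_gen P p\<^sub>0) \<cong>
    group_presentation E\<^sub>D
      ({(gen e, []) | e. e \<in> T} \<union>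
       {(gen_inv (e \<cdot>\<^bsub>S\<^esub> star S e) @ gen e, gen_inv (star S e) @ gen (star S e \<cdot>\<^bsub>S\<^esub> e)) | e. e \<in> E\<^sub>D} \<union>
       {(gen_inv e @ gen f, gen_inv g @ gen h) | e f g h.
          singular_square S e f g h \<and> {e, f, g, h} \<subseteq> D})"
proof -
  interpret pg_subgroup S P p\<^sub>0 D T
    using assms by (intro pg_subgroup.intro proj_alg_of_semigroup.intro
      proj_alg_of_semigroup_axioms.intro pg_subgroup_axioms.intro)
  obtain rho lam where "pg_subgroup_paths S P p\<^sub>0 D T rho lam"
  proof -
    obtain rho lam where "lam p\<^sub>0 = x p\<^sub>0"
      "\<forall>p \<in> PD. F.arr (x p\<^sub>0) (rho p) (x p) \<and> F.arr (x p\<^sub>0) (lam p) (x p)"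
      "\<forall>e \<in> T. lam (star S e \<cdot>\<^bsub>S\<^esub> e) = rho (e \<cdot>\<^bsub>S\<^esub> star S e) \<odot> x (star S e \<cdot>\<^bsub>S\<^esub> e) \<and>
        rho (e \<cdot>\<^bsub>S\<^esub> star S e) = lam (star S e \<cdot>\<^bsub>S\<^esub> e) \<odot> x (e \<cdot>\<^bsub>S\<^esub> star S e)"
      using tree_paths by blast
    then have "pg_subgroup_paths S P p\<^sub>0 D T rho lam"
      by unfold_locales blast+
    then show thesis by (rule that)
  qed
  from pg_subgroup_paths.maximal_subgroup_iso[OF this] show ?thesis
    unfolding maximal_subgroup_PG_star rels_def ED_def assms(6) .
qed

end
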